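(* Fix an integer $d \geq 2$ (constants in asymptotic notation may depend on $d$). For every $n \in \mathbb{N}$ and $\phi > 1$ there exist weights $w_1, \dots, w_n \geq 0$, intervals $[a_{ij}, b_{ij}] \subseteq [0,1]$ for $i \in [d]$, $j \in [n]$, each of length at least $1/\phi$ and with $a_{ij} \geq 0$, and a set $\mathcal{S} \subseteq \{0,1\}^n$, such that if the profits $v^{(i)}_j$ are chosen independently and uniformly at random in $[a_{ij}, b_{ij}]$, then the expected number of Pareto-optimal solutions of the $(d+1)$-dimensional knapsack problem with solution set $\mathcal{S}$ is at least \[ \min\left\{ \Omega_d\!\left( n^{d-1.5}\, \phi^{(d-\log d)(1-\Theta(1/\phi))}\right),\; 2^{\Theta(n)} \right\}. \]
   Context: The $(d+1)$-dimensional knapsack problem with solution set $\mathcal{S} \subseteq \{0,1\}^n$, weights $w \in \mathbb{R}^n$ and profits $v^{(1)}, \dots, v^{(d)} \in \mathbb{R}^n$ asks to minimize the weight $w \cdot x$ and maximize each profit $v^{(i)} \cdot x$ over $x \in \mathcal{S}$. For $x, y \in \mathcal{S}$, $y$ dominates $x$ if $w \cdot y \leq w \cdot x$ and $v^{(i)} \cdot y \geq v^{(i)} \cdot x$ for all $i \in [d]$, with at least one of these inequalities strict; $x \in \mathcal{S}$ is Pareto-optimal if no $y \in \mathcal{S}$ dominates it. Here $\log$ denotes the base-2 logarithm. *)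

theory Defs
  imports "HOL-Probability.Probability"
begin

(* Solutions x \<in> {0,1}^n are functions in {..<n} \<rightarrow>\<^sub>E {0,1}.
   Profits are indexed by pairs (i,j), i < d (profit index), j < n (item). *)

definition weight :: "nat \<Rightarrow> (nat \<Rightarrow> real) \<Rightarrow> (nat \<Rightarrow> real) \<Rightarrow> real" where
  "weight n w x = (\<Sum>j<n. w j * x j)"

definition profit :: "nat \<Rightarrow> (nat \<times> nat \<Rightarrow> real) \<Rightarrow> nat \<Rightarrow> (nat \<Rightarrow> real) \<Rightarrow> real" where
  "profit n v i x = (\<Sum>j<n. v (i, j) * x j)"

definition dominates ::
  "nat \<Rightarrow> nat \<Rightarrow> (nat \<Rightarrow> real) \<Rightarrow> (nat \<times> nat \<Rightarrow> real) \<Rightarrow> (nat \<Rightarrow> real) \<Rightarrow> (nat \<Rightarrow> real) \<Rightarrow> bool" where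
  "dominates d n w v y x \<longleftrightarrow>
     weight n w y \<le> weight n w x \<and> (\<forall>i<d. profit n v i y \<ge> profit n v i x) \<and>
     (weight n w y < weight n w x \<or> (\<exists>i<d. profit n v i y > profit n v i x))"

definition pareto_optimal ::
  "nat \<Rightarrow> nat \<Rightarrow> (nat \<Rightarrow> real) set \<Rightarrow> (nat \<Rightarrow> real) \<Rightarrow> (nat \<times> nat \<Rightarrow> real) \<Rightarrow> (nat \<Rightarrow> real) \<Rightarrow> bool" where
  "pareto_optimal d n S w v x \<longleftrightarrow> x \<in> S \<and> \<not> (\<exists>y\<in>S. dominates d n w v y x)"

definition num_pareto ::
  "nat \<Rightarrow> nat \<Rightarrow> (nat \<Rightarrow> real) set \<Rightarrow> (nat \<Rightarrow> real) \<Rightarrow> (nat \<times> nat \<Rightarrow> real) \<Rightarrow> nat" where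
  "num_pareto d n S w v = card {x. pareto_optimal d n S w v x}"

definition profit_distr ::
  "nat \<Rightarrow> nat \<Rightarrow> (nat \<Rightarrow> nat \<Rightarrow> real) \<Rightarrow> (nat \<Rightarrow> nat \<Rightarrow> real) \<Rightarrow> (nat \<times> nat \<Rightarrow> real) measure" where
  "profit_distr d n a b =
     PiM ({..<d} \<times> {..<n}) (\<lambda>(i, j). uniform_measure lborel {a i j .. b i j})"

end

(* Base part. Give p items of equal weight l = 1/phi profits in [0, l]. For multipliers u > 0, packing
   exactly the items j with sum_i u_i v_ij > l maximizes sum_i u_i profit_i - weight, so the result is
   Pareto-optimal. Let u range over a grid of R^(d-1) points with last coordinate 1. Two grid points
   at distance about 1/R pack an item differently with probability of order 1/R, so for
   R = p^(1 - 1/(2(d-1))) the union bound shows that, with probability at least 1/2, all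
   R^(d-1) ~ p^(d-3/2) packings are distinct.

   Amplification. Add k * d groups of m items each, where S forces every group to be packed entirely
   or not at all. Group t * d + i has profit about q 2^t per item in coordinate i, and at most l in
   the others, and weight proportional to 2^t. Since m q exceeds the total noise n l, dominance forces
   the binary numbers encoded in each coordinate to increase weakly, whereas the weight forces their
   sum not to increase. Hence all group choices agree and every base solution yields 2^(k d)
   Pareto-optimal ones. The only constraint, q 2^k <= 1 with q = 2 n l / m, allows
   2^k ~ phi^(1 - 1/d), which gives phi^(d-1) >= phi^(d - log d). *)
theory Submission
  imports Defs "HOL-Library.Nat_Bijection" "HOL-Real_Asymp.Real_Asymp"
begin

section \<open>Separating multipliers\<close>

text \<open>Fubini in the coordinate \<open>e\<close>: for almost every \<open>x\<close> in
  \<open>B\<close> the section of \<open>A\<close> has measure at least \<open>c\<close>, and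
  integrating over \<open>x\<close> gives the bound. The set \<open>Z\<close> may depend on
  \<open>x\<close>, so one profit can be revealed after all the others.\<close>

lemma emeasure_PiM_insert_ge:
  assumes "product_sigma_finite M" "finite J" "e \<notin> J"
    and A: "A \<in> sets (PiM (insert e J) M)" and B: "B \<in> sets (PiM J M)"
    and ae: "AE x in PiM J M. x \<in> B \<longrightarrow>
      (\<exists>Z\<in>sets (M e). c \<le> emeasure (M e) Z \<and> (\<forall>z\<in>Z. x(e := z) \<in> A))"
  shows "c * emeasure (PiM J M) B \<le> emeasure (PiM (insert e J) M) A"
proof -
  interpret product_sigma_finite M by fact
  have "c * emeasure (PiM J M) B = (\<integral>\<^sup>+x. c * indicator B x \<partial>PiM J M)"
    using B by (simp add: nn_integral_cmult_indicator)
  also have "\<dots> \<le> (\<integral>\<^sup>+x. (\<integral>\<^sup>+z. indicator A (x(e := z)) \<partial>M e) \<partial>PiM J M)"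
  proof (rule nn_integral_mono_AE)
    show "AE x in PiM J M. c * indicator B x \<le> (\<integral>\<^sup>+z. indicator A (x(e := z)) \<partial>M e)"
      using ae
    proof eventually_elim
      case (elim x)
      show ?case
      proof (cases "x \<in> B")
        case True
        with elim obtain Z where Z: "Z \<in> sets (M e)" "c \<le> emeasure (M e) Z"
          "\<forall>z\<in>Z. x(e := z) \<in> A" by blast
        have "c \<le> (\<integral>\<^sup>+z. indicator Z z \<partial>M e)" using Z by simp
        also have "\<dots> \<le> (\<integral>\<^sup>+z. indicator A (x(e := z)) \<partial>M e)"
          using Z by (intro nn_integral_mono) (auto simp: indicator_def)
        finally show ?thesis using True by simp
      qed simp
    qed
  qed
  also have "\<dots> = emeasure (PiM (insert e J) M) A"
    using A assms by (subst product_nn_integral_insert[symmetric]) auto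
  finally show ?thesis .
qed

abbreviation unif :: "real \<Rightarrow> real \<Rightarrow> real measure" where
  "unif a l \<equiv> uniform_measure lborel {a..a + l}"

lemma prob_space_unif: "l > 0 \<Longrightarrow> prob_space (unif a l)"
  by (intro prob_space_uniform_measure) auto

lemma emeasure_unif:
  assumes "l > 0" "B \<in> sets borel" "B \<subseteq> {a..a + l}" "emeasure lborel B = ennreal x" "x \<ge> 0"
  shows "emeasure (unif a l) B = ennreal (x / l)"
  using assms by (subst emeasure_uniform_measure) (auto simp: Int_absorb1 divide_ennreal)

lemma AE_unif: "AE y in unif a l. y \<in> {a..a + l}"
  by (rule AE_uniform_measureI) auto

definition factor :: "(nat \<Rightarrow> nat \<Rightarrow> real) \<Rightarrow> real \<Rightarrow> nat \<times> nat \<Rightarrow> real measure" where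
  "factor a l = (\<lambda>(i, j). unif (a i j) l)"

lemma profit_distr_eq:
  "profit_distr d n a (\<lambda>i j. a i j + l) = PiM ({..<d} \<times> {..<n}) (factor a l)"
  by (simp add: profit_distr_def factor_def)

lemma prob_space_factor: "l > 0 \<Longrightarrow> prob_space (factor a l q)"
  by (cases q) (auto simp: factor_def intro: prob_space_unif)

lemma sets_factor [measurable_cong, simp]: "sets (factor a l q) = sets borel"
  by (cases q) (auto simp: factor_def)

lemma space_factor [simp]: "space (factor a l q) = UNIV"
  by (cases q) (auto simp: factor_def)

lemma coordinate_measurable:
  assumes "q \<in> J"
  shows "(\<lambda>v. v q) \<in> borel_measurable (PiM J (factor a l))"
proof -
  have "(\<lambda>v. v q) \<in> measurable (PiM J (factor a l)) (factor a l q)"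
    using assms by (rule measurable_component_singleton)
  then show ?thesis by (simp cong: measurable_cong_sets)
qed

lemma product_sigma_finite_factor: "l > 0 \<Longrightarrow> product_sigma_finite (factor a l)"
  by (intro product_sigma_finite.intro prob_space_imp_sigma_finite prob_space_factor)

lemma AE_box:
  assumes "l > 0" "finite J"
  shows "AE v in PiM J (factor a l). \<forall>(i, j)\<in>J. v (i, j) \<in> {a i j..a i j + l}"
proof -
  have "AE v in PiM J (factor a l). \<forall>q\<in>J. v q \<in> {a (fst q) (snd q)..a (fst q) (snd q) + l}"
  proof (intro eventually_ball_finite ballI)
    fix q assume "q \<in> J"
    have "AE y in factor a l q. y \<in> {a (fst q) (snd q)..a (fst q) (snd q) + l}"
      unfolding factor_def split_beta by (rule AE_unif)
    with \<open>q \<in> J\<close> assms show "AE v in PiM J (factor a l). v q \<in> {a (fst q) (snd q)..a (fst q) (snd q) + l}"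
      by (intro AE_PiM_component prob_space_factor) auto
  qed (use assms in auto)
  then show ?thesis by eventually_elim (force simp: split_beta)
qed

text \<open>Grouping independent variables into disjoint blocks keeps them independent, so events
  that each look at one block multiply. Later, block \<open>j\<close> consists of the
  \<open>d\<close> profits of item \<open>j\<close>.\<close>

lemma indep_blocks:
  assumes "prob_space M" and ind: "prob_space.indep_vars M M' X I"
    and K: "\<And>j. j \<in> L \<Longrightarrow> K j \<subseteq> I" "disjoint_family_on K L" and L: "finite L"
    and A: "\<And>j. j \<in> L \<Longrightarrow> A j \<in> sets (PiM (K j) M')"
  shows "measure M {v\<in>space M. \<forall>j\<in>L. restrict (\<lambda>i. X i v) (K j) \<in> A j}
    = (\<Prod>j\<in>L. measure M {v\<in>space M. restrict (\<lambda>i. X i v) (K j) \<in> A j})"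
proof (cases "L = {}")
  case False
  interpret prob_space M by fact
  have "prob (\<Inter>j\<in>L. (\<lambda>v. restrict (\<lambda>i. X i v) (K j)) -` A j \<inter> space M)
    = (\<Prod>j\<in>L. prob ((\<lambda>v. restrict (\<lambda>i. X i v) (K j)) -` A j \<inter> space M))"
    by (rule indep_varsD[OF indep_vars_restrict[OF ind K]]) (use False L A in auto)
  moreover have "(\<Inter>j\<in>L. (\<lambda>v. restrict (\<lambda>i. X i v) (K j)) -` A j \<inter> space M)
     = {v\<in>space M. \<forall>j\<in>L. restrict (\<lambda>i. X i v) (K j) \<in> A j}" using False by auto
  moreover have "(\<lambda>v. restrict (\<lambda>i. X i v) (K j)) -` A j \<inter> space M
     = {v\<in>space M. restrict (\<lambda>i. X i v) (K j) \<in> A j}" for j by auto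
  ultimately show ?thesis by simp
qed (use prob_space.prob_space[OF assms(1)] in auto)

text \<open>On the space of \<open>PiM I M\<close> restriction to \<open>I\<close> is the identity,
  so the joint law of the coordinates is \<open>PiM I M\<close> itself, the product of their
  marginals; this characterizes independence.\<close>

lemma indep_vars_PiM_coordinates:
  assumes "\<And>i. i \<in> I \<Longrightarrow> prob_space (M i)" "I \<noteq> {}"
  shows "prob_space.indep_vars (PiM I M) M (\<lambda>i v. v i) I"
proof -
  interpret prob_space "PiM I M" by (intro prob_space_PiM assms)
  have "distr (PiM I M) (PiM I M) (\<lambda>x. \<lambda>i\<in>I. x i) = distr (PiM I M) (PiM I M) (\<lambda>x. x)"
    by (intro distr_cong) (auto simp: space_PiM restrict_PiE_iff)
  also have "\<dots> = PiM I M" by simp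
  also have "\<dots> = (\<Pi>\<^sub>M i\<in>I. distr (PiM I M) (M i) (\<lambda>x. x i))"
    by (intro PiM_cong) (auto simp: distr_PiM_component assms)
  finally show ?thesis
    by (subst indep_vars_iff_distr_eq_PiM') (use assms in auto)
qed

section \<open>Separation of grid multipliers by random profits\<close>

text \<open>Packing of item \<^term>\<open>j\<close> that is optimal for the multipliers \<^term>\<open>lam\<close>, when its weight is \<^term>\<open>l\<close>.\<close>

definition thr :: "nat \<Rightarrow> real \<Rightarrow> (nat \<Rightarrow> real) \<Rightarrow> (nat \<times> nat \<Rightarrow> real) \<Rightarrow> nat \<Rightarrow> real" where
  "thr d l lam v j = (if l < (\<Sum>i<d. lam i * v (i, j)) then 1 else 0)"

text \<open>Keeping the first \<open>d - 1\<close> multipliers at most \<open>1 / d\<close> ensures that, for profits in \<open>[0, l]\<close>,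
  the decision on an item changes within the range \<open>[0, l]\<close> of its last profit.\<close>

definition lam :: "nat \<Rightarrow> nat \<Rightarrow> (nat \<Rightarrow> nat) \<Rightarrow> nat \<Rightarrow> real" where
  "lam d R z i = (if i < d - 1 then (real (z i) + 1) / (real d * real R) else 1)"

lemma thr_measurable:
  assumes "{..<d} \<times> {j} \<subseteq> J"
  shows "(\<lambda>v. thr d l u v j) \<in> borel_measurable (PiM J (factor a l'))"
proof -
  have [measurable]: "(\<lambda>v. v (i, j)) \<in> borel_measurable (PiM J (factor a l'))" if "i < d" for i
    using that assms by (intro coordinate_measurable) auto
  show ?thesis unfolding thr_def by measurable
qed

text \<open>The conditional probability that the last profit separates the two multipliers is
  proportional to the difference of the two partial sums over the other profits; by varying a
  coordinate where the multipliers differ, this difference is large with probability at least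
  \<open>1 / 4\<close>.\<close>

lemma separation_prob:
  assumes d: "d \<ge> 2" and l: "l > 0" and R: "R > 0" and j: "j < n"
    and a: "\<And>i. i < d \<Longrightarrow> a i j = 0"
    and z: "z \<in> {..<d - 1} \<rightarrow>\<^sub>E {..<R}" "z' \<in> {..<d - 1} \<rightarrow>\<^sub>E {..<R}" "z \<noteq> z'"
  defines "P \<equiv> PiM ({..<d} \<times> {..<n}) (factor a l)"
  shows "1 / (16 * real d * real R) \<le>
    measure P {v\<in>space P. thr d l (lam d R z) v j \<noteq> thr d l (lam d R z') v j}"
proof -
  define I where "I = {..<d} \<times> {..<n}"
  define F where "F = factor a l"
  have psf: "product_sigma_finite F" unfolding F_def using l by (rule product_sigma_finite_factor)
  obtain i where i: "i < d - 1" "z i \<noteq> z' i"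
    using z by (metis PiE_ext lessThan_iff)
  \<comment> \<open>\<open>e\<close> is the position of the last profit of the item, revealed last;
    \<open>f\<close> belongs to a multiplier in which \<open>z\<close> and \<open>z'\<close> differ
    and is revealed just before.\<close>
  define e where "e = (d - 1, j)"
  define f where "f = (i, j)"
  have ef: "e \<noteq> f" "e \<in> I" "f \<in> I" using i j d by (auto simp: e_def f_def I_def)
  define J where "J = I - {e}"
  define J' where "J' = J - {f}"
  have ins: "insert e J = I" "insert f J' = J" and fin: "finite J" "finite J'" "finite I"
    and nin: "e \<notin> J" "f \<notin> J'"
    using ef by (auto simp: J_def J'_def I_def)
  define u where "u = (\<lambda>z (x :: nat \<times> nat \<Rightarrow> real). \<Sum>i<d - 1. lam d R z i * x (i, j))"
  have inJ: "(i, j) \<in> J" if "i < d - 1" for i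
    using that d j by (auto simp: J_def I_def e_def)
  \<comment> \<open>The spacing of the grid, hence a lower bound for the difference of the two
    multipliers in coordinate \<open>i\<close>.\<close>
  define \<delta> where "\<delta> = 1 / (real d * real R)"
  have \<delta>: "\<delta> > 0" using d R by (simp add: \<delta>_def)
  define B where "B = {x\<in>space (PiM J F). l * \<delta> / 4 \<le> \<bar>u z x - u z' x\<bar>}"
  have comp: "(\<lambda>v. v (i, j)) \<in> borel_measurable (PiM J F)" if "i < d - 1" for i
    unfolding F_def using inJ[OF that] by (rule coordinate_measurable)
  have um [measurable]: "u z \<in> borel_measurable (PiM J F)" for z
    unfolding u_def using comp by (intro borel_measurable_sum borel_measurable_times) auto
  have B: "B \<in> sets (PiM J F)" unfolding B_def by measurable
  have lamd: "lam d R z i - lam d R z' i = \<delta> * (real (z i) - real (z' i))"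
    using i by (simp add: lam_def \<delta>_def diff_divide_distrib[symmetric])
  have D: "\<delta> \<le> \<bar>lam d R z i - lam d R z' i\<bar>"
  proof -
    have "1 \<le> \<bar>real (z i) - real (z' i)\<bar>" using i by linarith
    then show ?thesis using \<delta> by (simp add: lamd abs_mult)
  qed
  have spJ: "x(f := y) \<in> space (PiM J F)" if "x \<in> space (PiM J' F)" for x y
    using that ins(2) by (auto simp: space_PiM F_def PiE_iff extensional_def)
  have spI: "x(e := y) \<in> space (PiM I F)" if "x \<in> space (PiM J F)" for x y
    using that ins(1) by (auto simp: space_PiM F_def PiE_iff extensional_def)
  have F_f: "F f = unif 0 l" and F_e: "F e = unif 0 l"
    using a i d by (auto simp: F_def f_def e_def factor_def)
  have step1: "ennreal (1 / 4) \<le> emeasure (PiM J F) B"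
  proof -
    have "ennreal (1/4) * emeasure (PiM J' F) (space (PiM J' F)) \<le> emeasure (PiM (insert f J') F) B"
    proof (rule emeasure_PiM_insert_ge[OF psf fin(2) nin(2)])
      show "AE x in PiM J' F. x \<in> space (PiM J' F) \<longrightarrow>
        (\<exists>Z\<in>sets (F f). ennreal (1/4) \<le> emeasure (F f) Z \<and> (\<forall>z\<in>Z. x(f := z) \<in> B))"
      proof (intro AE_I2 impI)
        fix x assume x: "x \<in> space (PiM J' F)"
        define \<Delta> where "\<Delta> = lam d R z i - lam d R z' i"
        define r where "r = u z (x(f := 0)) - u z' (x(f := 0))"
        have uy: "u z (x(f := y)) - u z' (x(f := y)) = \<Delta> * y + r" for y
        proof -
          have "u w (x(f := y)) = lam d R w i * y + u w (x(f := 0))" for w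
          proof -
            have "u w (x(f := y)) = lam d R w i * y + (\<Sum>i'\<in>{..<d - 1} - {i}. lam d R w i' * x (i', j))" for y
              unfolding u_def using i by (subst sum.remove[of _ i]) (auto simp: f_def intro!: sum.cong)
            from this[of y] this[of 0] show ?thesis by simp
          qed
          from this[of z] this[of z'] show ?thesis by (simp add: \<Delta>_def r_def algebra_simps)
        qed
        \<comment> \<open>As a function of the profit \<open>y\<close> at \<open>f\<close>, the
          difference of the partial sums is affine with slope at least \<open>\<delta>\<close> in
          absolute value. \<open>\<rho>\<close> is its root, so the difference is large once
          \<open>y\<close> is \<open>l / 4\<close> away from \<open>\<rho>\<close>.\<close>
        define \<rho> where "\<rho> = - r / \<Delta>"
        have \<Delta>: "\<delta> \<le> \<bar>\<Delta>\<bar>" using D by (simp add: \<Delta>_def)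
        have *: "l * \<delta> / 4 \<le> \<bar>\<Delta> * y + r\<bar>" if "l / 4 \<le> \<bar>y - \<rho>\<bar>" for y
        proof -
          have "\<delta> * (l / 4) \<le> \<bar>\<Delta>\<bar> * \<bar>y - \<rho>\<bar>"
            using that \<Delta> \<delta> l by (intro mult_mono) auto
          also have "\<dots> = \<bar>\<Delta> * y + r\<bar>" using \<Delta> \<delta>
            by (subst abs_mult[symmetric]) (simp add: \<rho>_def algebra_simps)
          finally show ?thesis by (simp add: mult.commute)
        qed
        have mem: "x(f := y) \<in> B" if "l / 4 \<le> \<bar>y - \<rho>\<bar>" for y
          using *[OF that] spJ[OF x] by (simp add: B_def uy)
        show "\<exists>Z\<in>sets (F f). ennreal (1/4) \<le> emeasure (F f) Z \<and> (\<forall>z\<in>Z. x(f := z) \<in> B)"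
        \<comment> \<open>For a root at or above \<open>l / 2\<close> the lowest quarter of [0, l]
          keeps distance \<open>l / 4\<close> from it, otherwise the highest quarter does.\<close>
        proof (cases "\<rho> \<ge> l / 2")
          case True
          have "emeasure (unif 0 l) {0..l/4} = ennreal ((l / 4) / l)"
            using l by (intro emeasure_unif) auto
          with True l show ?thesis unfolding F_f
            by (intro bexI[of _ "{0..l/4}"] conjI ballI mem) auto
        next
          case False
          have "emeasure (unif 0 l) {3*l/4..l} = ennreal ((l / 4) / l)"
            using l by (intro emeasure_unif) auto
          with False l show ?thesis unfolding F_f
            by (intro bexI[of _ "{3*l/4..l}"] conjI ballI mem) auto
        qed
      qed
    qed (use B ins in auto)
    moreover have "emeasure (PiM J' F) (space (PiM J' F)) = 1"
      by (intro prob_space.emeasure_space_1 prob_space_PiM) (auto simp: F_def prob_space_factor l)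
    ultimately show ?thesis by (simp add: ins)
  qed
  define A where "A = {v\<in>space P. thr d l (lam d R z) v j \<noteq> thr d l (lam d R z') v j}"
  have P: "P = PiM I F" by (simp add: P_def I_def F_def)
  have A: "A \<in> sets (PiM I F)"
  proof -
    define T where "T = (\<lambda>z v. thr d l (lam d R z) v j)"
    have T: "T z \<in> borel_measurable (PiM I F)" for z
      unfolding F_def T_def using j by (intro thr_measurable) (auto simp: I_def)
    have "{v\<in>space (PiM I F). T z v \<noteq> T z' v} \<in> sets (PiM I F)"
      by (intro borel_measurable_neq T)
    then show ?thesis by (simp only: A_def P T_def)
  qed
  have "ennreal (\<delta> / 4) * emeasure (PiM J F) B \<le> emeasure (PiM (insert e J) F) A"
  proof (rule emeasure_PiM_insert_ge[OF psf fin(1) nin(1)])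
    have "AE x in PiM J F. \<forall>(i, j)\<in>J. x (i, j) \<in> {a i j..a i j + l}"
      unfolding F_def by (rule AE_box[OF l fin(1)])
    then show "AE x in PiM J F. x \<in> B \<longrightarrow>
        (\<exists>Z\<in>sets (F e). ennreal (\<delta> / 4) \<le> emeasure (F e) Z \<and> (\<forall>z\<in>Z. x(e := z) \<in> A))"
    proof eventually_elim
      case (elim x)
      have x: "x (i, j) \<in> {0..l}" if "i < d - 1" for i
        using elim inJ[OF that] a[of i] that by auto
      \<comment> \<open>The \<open>d - 1\<close> multipliers are at most \<open>1 / d\<close> and
        the profits at most \<open>l\<close>, so the partial sums stay in [0, l]; this places the
        interval \<open>Z\<close> below inside the range of the last profit.\<close>
      have u: "0 \<le> u w x \<and> u w x \<le> l" if "w \<in> {..<d - 1} \<rightarrow>\<^sub>E {..<R}" for w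
      proof
        have w: "0 \<le> lam d R w i \<and> lam d R w i \<le> 1 / d" if "i < d - 1" for i
        proof -
          have "w i < R" using \<open>w \<in> _\<close> that by auto
          then have "real (w i) + 1 \<le> R" by linarith
          then have "(real (w i) + 1) / (real d * real R) \<le> real R / (real d * real R)"
            by (intro divide_right_mono) auto
          also have "\<dots> = 1 / real d" using R by simp
          finally show ?thesis using that by (simp add: lam_def)
        qed
        show "0 \<le> u w x" unfolding u_def using w x by (intro sum_nonneg mult_nonneg_nonneg) auto
        have "u w x \<le> (\<Sum>i<d - 1. 1 / d * l)"
          unfolding u_def using w x l by (intro sum_mono mult_mono) auto
        also have "\<dots> \<le> l" using l d by (simp add: field_simps)
        finally show "u w x \<le> l" .
      qed
      \<comment> \<open>Formulated for an unordered pair, so that \<open>w\<close> can denote the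
        grid point with the smaller partial sum.\<close>
      have key: "\<exists>Z\<in>sets (F e). ennreal (\<delta> / 4) \<le> emeasure (F e) Z \<and> (\<forall>y\<in>Z. x(e := y) \<in> A)"
        if xB: "x \<in> B" and wz: "{w, w'} = {z, z'}" and lt: "u w x \<le> u w' x" for w w'
      proof -
        have ww: "w \<in> {..<d - 1} \<rightarrow>\<^sub>E {..<R}" "w' \<in> {..<d - 1} \<rightarrow>\<^sub>E {..<R}"
          using z wz by (auto simp: doubleton_eq_iff)
        \<comment> \<open>The last multiplier is 1, so the item is packed exactly if its last profit
          exceeds \<open>l\<close> minus the partial sum. On \<open>Z\<close> only \<open>w'\<close>
          packs it; the half-open form matches the strict test in \<open>thr\<close>.\<close>
        define Z where "Z = {l - u w' x<..l - u w x}"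
        have "emeasure (F e) Z = ennreal ((u w' x - u w x) / l)"
          unfolding Z_def F_e using l lt u[OF ww(1)] u[OF ww(2)] by (intro emeasure_unif) auto
        moreover have "l * (\<delta> / 4) \<le> u w' x - u w x"
          using xB wz lt by (auto simp: B_def doubleton_eq_iff)
        then have "\<delta> / 4 \<le> (u w' x - u w x) / l"
          using l by (simp add: field_simps)
        moreover have "x(e := y) \<in> A" if "y \<in> Z" for y
        proof -
          have s: "(\<Sum>i<d. lam d R q i * (x(e := y)) (i, j)) = u q x + y" for q
          proof -
            have "d = Suc (d - 1)" using d by simp
            then have "(\<Sum>i<d. lam d R q i * (x(e := y)) (i, j)) =
              (\<Sum>i<d-1. lam d R q i * (x(e := y)) (i, j)) + lam d R q (d - 1) * y"
              by (metis (no_types, lifting) e_def fun_upd_same sum.lessThan_Suc)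
            also have "(\<Sum>i<d-1. lam d R q i * (x(e := y)) (i, j)) = u q x"
              unfolding u_def by (intro sum.cong) (auto simp: e_def)
            finally show ?thesis by (simp add: lam_def)
          qed
          have "thr d l (lam d R w) (x(e := y)) j \<noteq> thr d l (lam d R w') (x(e := y)) j"
            unfolding thr_def s using that by (auto simp: Z_def)
          then show ?thesis using wz spI xB unfolding A_def P B_def
            by (auto simp: doubleton_eq_iff)
        qed
        ultimately show ?thesis
          by (intro bexI[of _ Z]) (auto simp: Z_def F_def ennreal_leI)
      qed
      show ?case using key[of z z'] key[of z' z] by (metis insert_commute linear)
    qed
  qed (use A B ins in auto)
  then have "ennreal (\<delta> / 4) * emeasure (PiM J F) B \<le> emeasure P A" by (simp add: ins P)
  moreover have "ennreal (\<delta> / 4) * ennreal (1 / 4) \<le> ennreal (\<delta> / 4) * emeasure (PiM J F) B"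
    by (intro mult_left_mono step1) auto
  ultimately have "ennreal (\<delta> / 4 * (1 / 4)) \<le> emeasure P A"
    using \<delta> by (subst ennreal_mult) auto
  moreover interpret prob_space P unfolding P_def
    by (intro prob_space_PiM prob_space_factor l)
  have "emeasure P A = ennreal (prob A)" by (rule emeasure_eq_measure)
  ultimately have "\<delta> / 16 \<le> prob A" by simp
  then show ?thesis by (simp add: A_def \<delta>_def field_simps)
qed

text \<open>Union bound over pairs of grid points. Decisions on different items depend on disjoint
  blocks of profits, so two points agree on all \<open>p\<close> items with probability at most
  \<open>(1 - q) ^ p \<le> exp (- p * q)\<close>, where \<open>q\<close> comes from
  \<open>separation_prob\<close>; \<open>small\<close> makes the sum over all pairs at most
  1/2.\<close>

lemma thr_inj_prob:
  assumes d: "d \<ge> 2" and l: "l > 0" and R: "R > 0" and p: "p \<le> n"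
    and a: "\<And>i j. i < d \<Longrightarrow> j < p \<Longrightarrow> a i j = 0"
    and small: "(real R ^ (d - 1))\<^sup>2 * exp (- real p / (16 * real d * real R)) \<le> 1 / 2"
  defines "P \<equiv> PiM ({..<d} \<times> {..<n}) (factor a l)"
    and "G \<equiv> {..<d - 1} \<rightarrow>\<^sub>E {..<R}"
  shows "\<exists>E\<in>sets P. 1 / 2 \<le> measure P E \<and>
    (\<forall>v\<in>E. \<forall>z\<in>G. \<forall>z'\<in>G. z \<noteq> z' \<longrightarrow>
       (\<exists>j<p. thr d l (lam d R z) v j \<noteq> thr d l (lam d R z') v j))"
proof -
  interpret prob_space P unfolding P_def by (intro prob_space_PiM prob_space_factor l)
  define q where "q = 1 / (16 * real d * real R)"
  define T where "T = (\<lambda>z j v. thr d l (lam d R z) v j)"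
  define C where "C = (\<lambda>zz. {v\<in>space P. \<forall>j\<in>{..<p}. T (fst zz) j v = T (snd zz) j v})"
  define D where "D = {(z, z') \<in> G \<times> G. z \<noteq> z'}"
  have finG: "finite G" unfolding G_def by (intro finite_PiE) auto
  then have finD: "finite D" by (intro finite_subset[of D "G \<times> G"]) (auto simp: D_def)
  have T_meas: "T z j \<in> borel_measurable P" if "j < n" for z j
    unfolding P_def T_def using that by (intro thr_measurable) auto
  have sets_C: "C zz \<in> sets P" for zz
    unfolding C_def
  proof (intro sets.sets_Collect_finite_All)
    fix j assume "j \<in> {..<p}"
    then have [measurable]: "T z j \<in> borel_measurable P" for z
      using T_meas p by auto
    show "{v\<in>space P. T (fst zz) j v = T (snd zz) j v} \<in> sets P" by measurable
  qed auto
  have prob_C: "prob (C (z, z')) \<le> exp (- real p / (16 * real d * real R))"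
    if zz: "(z, z') \<in> D" for z z'
  proof -
    define A where "A = (\<lambda>j. {x\<in>space (PiM ({..<d} \<times> {j}) (factor a l)). T z j x = T z' j x})"
    have Tr: "T z j (restrict (\<lambda>i. v i) ({..<d} \<times> {j})) = T z j v" for z j v
    proof -
      have "(\<Sum>i<d. lam d R z i * restrict (\<lambda>i. v i) ({..<d} \<times> {j}) (i, j)) = (\<Sum>i<d. lam d R z i * v (i, j))"
        by (intro sum.cong) auto
      then show ?thesis by (simp only: T_def thr_def)
    qed
    have sA: "A j \<in> sets (PiM ({..<d} \<times> {j}) (factor a l))" for j
    proof -
      have [measurable]: "T z j \<in> borel_measurable (PiM ({..<d} \<times> {j}) (factor a l))" for z
        unfolding T_def by (intro thr_measurable) auto
      show ?thesis unfolding A_def by measurable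
    qed
    have rA: "restrict (\<lambda>i. v i) ({..<d} \<times> {j}) \<in> A j \<longleftrightarrow> T z j v = T z' j v" for v j
      unfolding A_def by (auto simp: Tr space_PiM)
    have "prob (C (z, z')) = prob {v\<in>space P. \<forall>j\<in>{..<p}. restrict (\<lambda>i. v i) ({..<d} \<times> {j}) \<in> A j}"
      by (simp add: rA C_def)
    also have "\<dots> = (\<Prod>j\<in>{..<p}. prob {v\<in>space P. restrict (\<lambda>i. v i) ({..<d} \<times> {j}) \<in> A j})"
    \<comment> \<open>Independence of the coordinates is available for a nonempty index set, which
      \<open>p > 0\<close> provides through \<open>p \<le> n\<close>; for \<open>p = 0\<close> both
      sides are 1.\<close>
    proof (cases "p = 0")
      case False
      show ?thesis
      proof (rule indep_blocks)
        show "indep_vars (factor a l) (\<lambda>i v. v i) ({..<d} \<times> {..<n})"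
          unfolding P_def using d p False
          by (intro indep_vars_PiM_coordinates prob_space_factor l) (auto simp: lessThan_empty_iff bot_nat_def)
      qed (use sA p in \<open>auto simp: prob_space_axioms disjoint_family_on_def\<close>)
    qed (use prob_space in auto)
    also have "\<dots> \<le> (\<Prod>j\<in>{..<p}. exp (- q))"
    proof (intro prod_mono conjI)
      fix j assume j: "j \<in> {..<p}"
      then have s: "{v\<in>space P. T z j v \<noteq> T z' j v} \<in> sets P"
        using p by (intro borel_measurable_neq T_meas) auto
      have "prob {v\<in>space P. restrict (\<lambda>i. v i) ({..<d} \<times> {j}) \<in> A j}
          = prob (space P - {v\<in>space P. T z j v \<noteq> T z' j v})"
        by (intro arg_cong[where f = prob]) (auto simp: rA)
      also have "\<dots> = 1 - prob {v\<in>space P. T z j v \<noteq> T z' j v}"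
        using s by (rule prob_compl)
      also have "q \<le> prob {v\<in>space P. T z j v \<noteq> T z' j v}"
        unfolding T_def P_def q_def using zz j p
        by (intro separation_prob d l R a) (auto simp: D_def G_def)
      then have "1 - prob {v\<in>space P. T z j v \<noteq> T z' j v} \<le> 1 + (- q)" by simp
      also have "\<dots> \<le> exp (- q)" by (rule exp_ge_add_one_self)
      finally show "prob {v\<in>space P. restrict (\<lambda>i. v i) ({..<d} \<times> {j}) \<in> A j} \<le> exp (- q)" .
    qed auto
    also have "\<dots> = exp (- real p / (16 * real d * real R))"
      by (simp add: exp_of_nat_mult[symmetric] q_def)
    finally show ?thesis .
  qed
  define E where "E = space P - (\<Union>zz\<in>D. C zz)"
  have U: "(\<Union>zz\<in>D. C zz) \<in> sets P" using finD sets_C by auto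
  have "prob (\<Union>zz\<in>D. C zz) \<le> (\<Sum>zz\<in>D. prob (C zz))"
    using finD sets_C by (intro finite_measure_subadditive_finite) auto
  also have "\<dots> \<le> (\<Sum>zz\<in>D. exp (- real p / (16 * real d * real R)))"
    using prob_C by (intro sum_mono) auto
  also have "\<dots> = real (card D) * exp (- real p / (16 * real d * real R))" by simp
  also have "\<dots> \<le> (real R ^ (d - 1))\<^sup>2 * exp (- real p / (16 * real d * real R))"
  proof (intro mult_right_mono)
    have "card D \<le> card (G \<times> G)" using finG by (intro card_mono) (auto simp: D_def)
    also have "\<dots> = (R ^ (d - 1))\<^sup>2"
      by (simp add: card_cartesian_product G_def card_PiE power2_eq_square)
    finally show "real (card D) \<le> (real R ^ (d - 1))\<^sup>2"
      by (metis of_nat_le_iff of_nat_power)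
  qed auto
  finally have "prob (\<Union>zz\<in>D. C zz) \<le> 1 / 2" using small by linarith
  then have "1 / 2 \<le> prob E" unfolding E_def using U by (simp add: prob_compl)
  moreover have "E \<in> sets P" using U by (simp add: E_def)
  moreover have "\<exists>j<p. T z j v \<noteq> T z' j v" if "v \<in> E" "z \<in> G" "z' \<in> G" "z \<noteq> z'" for v z z'
    using that by (auto simp: E_def C_def D_def)
  ultimately show ?thesis unfolding T_def by blast
qed

section \<open>Amplification by groups of items\<close>

text \<open>Items below \<^term>\<open>p\<close> are the base items; group \<^term>\<open>g\<close> consists of the \<^term>\<open>m\<close> items from
  \<^term>\<open>p + g * m\<close> on, and belongs to profit \<^term>\<open>g mod d\<close> and bit \<^term>\<open>g div d\<close>. Items after the
  last group are never packed.\<close>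

definition enc :: "nat \<Rightarrow> nat \<Rightarrow> nat \<Rightarrow> (nat \<Rightarrow> real) \<Rightarrow> nat set \<Rightarrow> nat \<Rightarrow> real" where
  "enc n p m z G =
    (\<lambda>j\<in>{..<n}. if j < p then z j else if (j - p) div m \<in> G then 1 else 0)"

definition sols :: "nat \<Rightarrow> nat \<Rightarrow> nat \<Rightarrow> nat \<Rightarrow> (nat \<Rightarrow> real) set" where
  "sols n p m K = {enc n p m z G |z G. z \<in> {..<p} \<rightarrow> {0, 1} \<and> G \<subseteq> {..<K}}"

text \<open>For \<open>l \<le> 1\<close> the factor \<open>p + 1\<close> exceeds the total weight of
  the base items, so one unit of a binary number outweighs any change among them. All profits share
  one weight scale, so the groups enter the weight only through the sum of the levels.\<close>

definition item_weight :: "nat \<Rightarrow> real \<Rightarrow> nat \<Rightarrow> nat \<Rightarrow> nat \<Rightarrow> real" where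
  "item_weight d l p m j =
    (if j < p then l else (real p + 1) * 2 ^ ((j - p) div m div d))"

text \<open>These become the left ends of the profit intervals: bit \<open>t\<close> of profit
  \<open>i\<close> is worth \<open>q * 2 ^ t\<close> per item, while base items and items after the
  last group start at 0.\<close>

definition offset :: "nat \<Rightarrow> real \<Rightarrow> nat \<Rightarrow> nat \<Rightarrow> nat \<Rightarrow> nat \<Rightarrow> nat \<Rightarrow> real" where
  "offset d q p m K i j =
    (if p \<le> j \<and> (j - p) div m < K \<and> (j - p) div m mod d = i
     then q * 2 ^ ((j - p) div m div d) else 0)"

text \<open>The number whose binary digits record which groups of profit \<open>i\<close> are
  packed.\<close>

definition level :: "nat \<Rightarrow> nat set \<Rightarrow> nat \<Rightarrow> nat" where
  "level d G i = (\<Sum>g\<in>{g\<in>G. g mod d = i}. 2 ^ (g div d))"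

section \<open>Weights and profits of encoded solutions\<close>

text \<open>Common summation rule for weights and offsets. After a shift by \<open>p\<close> the
  range is cut into blocks of length \<open>m\<close> on which the quotient is constant; indices
  from \<open>p + K * m\<close> on have quotient at least \<open>K\<close>, outside
  \<open>G\<close>, and contribute nothing.\<close>

lemma sum_blocks:
  fixes f :: "nat \<Rightarrow> real"
  assumes m: "m > 0" and n: "p + K * m \<le> n" and G: "G \<subseteq> {..<K}"
  shows "(\<Sum>j<n. if j < p then b j else if (j - p) div m \<in> G then f ((j - p) div m) else 0)
    = (\<Sum>j<p. b j) + real m * (\<Sum>g\<in>G. f g)"
proof -
  define h where "h = (\<lambda>j. if j div m \<in> G then f (j div m) else 0)"
  let ?F = "\<lambda>j. if j < p then b j else h (j - p)"
  have "sum ?F {..<n} = sum ?F {..<p} + sum ?F {p..<n}"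
    using n by (subst sum.union_disjoint[symmetric]) (auto intro: sum.cong)
  also have "sum ?F {..<p} = (\<Sum>j<p. b j)" by (intro sum.cong) auto
  also have "sum ?F {p..<n} = (\<Sum>j<n - p. h j)"
    by (intro sum.reindex_bij_witness[of _ "\<lambda>j. j + p" "\<lambda>j. j - p"]) auto
  also have "\<dots> = (\<Sum>j<K * m. h j)"
  proof (intro sum.mono_neutral_right ballI)
    fix j assume "j \<in> {..<n - p} - {..<K * m}"
    then have "K \<le> j div m" using m by (simp add: less_eq_div_iff_mult_less_eq)
    then show "h j = 0" using G by (auto simp: h_def)
  qed (use n in auto)
  also have "\<dots> = (\<Sum>g<K. \<Sum>j\<in>{g * m..<g * m + m}. h j)"
    by (rule sum.nat_group[symmetric])
  also have "\<dots> = (\<Sum>g<K. real m * (if g \<in> G then f g else 0))"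
  proof (intro sum.cong refl)
    fix g
    have "(\<Sum>j\<in>{g * m..<g * m + m}. h j) = (\<Sum>j\<in>{g * m..<g * m + m}. if g \<in> G then f g else 0)"
    proof (intro sum.cong refl)
      fix j assume "j \<in> {g * m..<g * m + m}"
      then have "j div m = g" by (intro div_nat_eqI) (auto simp: mult.commute)
      then show "h j = (if g \<in> G then f g else 0)" by (simp add: h_def)
    qed
    then show "(\<Sum>j\<in>{g * m..<g * m + m}. h j) = real m * (if g \<in> G then f g else 0)" by simp
  qed
  also have "\<dots> = real m * (\<Sum>g\<in>G. f g)"
    using G by (simp add: sum_distrib_left[symmetric] sum.If_cases Int_absorb1)
  finally show ?thesis unfolding h_def .
qed

text \<open>Uniqueness of binary expansions: \<open>level d G i\<close> is the
  \<open>set_encode\<close> of the quotients of the groups with residue \<open>i\<close>, and a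
  group is recovered from its quotient and residue modulo \<open>d\<close>.\<close>

lemma level_inj:
  assumes d: "d > 0" and fin: "finite G" "finite G'"
    and eq: "\<And>i. i < d \<Longrightarrow> level d G i = level d G' i"
  shows "G = G'"
proof -
  have inj: "inj_on (\<lambda>g. g div d) {g. g mod d = i}" for i
    by (intro inj_onI) (metis div_mult_mod_eq mem_Collect_eq)
  have lev: "level d H i = set_encode ((\<lambda>g. g div d) ` {g\<in>H. g mod d = i})" for H i
    unfolding level_def set_encode_def
    by (subst sum.reindex) (auto intro: inj_on_subset[OF inj])
  have mem: "g \<in> H \<longleftrightarrow> g div d \<in> (\<lambda>g. g div d) ` {h\<in>H. h mod d = g mod d}" for g H
    by (auto dest: inj_onD[OF inj[of "g mod d"]])
  have "(\<lambda>g. g div d) ` {g\<in>G. g mod d = i} = (\<lambda>g. g div d) ` {g\<in>G'. g mod d = i}" if "i < d" for i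
    using eq[OF that] fin by (simp add: lev set_encode_eq)
  then have "g \<in> G \<longleftrightarrow> g \<in> G'" for g
    using d mem[of g G] mem[of g G'] by simp
  then show ?thesis by blast
qed

lemma sum_level:
  assumes "d > 0" "finite G"
  shows "(\<Sum>i<d. level d G i) = (\<Sum>g\<in>G. 2 ^ (g div d))"
  unfolding level_def using assms by (intro sum.group) auto

lemma weight_enc:
  assumes "d > 0" "m > 0" "p + K * m \<le> n" "G \<subseteq> {..<K}"
  shows "weight n (item_weight d l p m) (enc n p m z G)
    = l * (\<Sum>j<p. z j) + real m * (real p + 1) * real (\<Sum>i<d. level d G i)"
proof -
  have "finite G" using assms(4) finite_subset by blast
  have "weight n (item_weight d l p m) (enc n p m z G) =
    (\<Sum>j<n. if j < p then l * z j else if (j - p) div m \<in> G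
       then (\<lambda>g. (real p + 1) * 2 ^ (g div d)) ((j - p) div m) else 0)"
    unfolding weight_def by (intro sum.cong) (auto simp: item_weight_def enc_def)
  also have "\<dots> = (\<Sum>j<p. l * z j) + real m * (\<Sum>g\<in>G. (real p + 1) * 2 ^ (g div d))"
    by (rule sum_blocks) (use assms in auto)
  finally show ?thesis using assms(1) \<open>finite G\<close>
    by (simp add: sum_level sum_distrib_left mult.assoc)
qed

lemma sum_offset_enc:
  assumes "m > 0" "p + K * m \<le> n" "G \<subseteq> {..<K}"
  shows "(\<Sum>j<n. offset d q p m K i j * enc n p m z G j) = real m * q * real (level d G i)"
proof -
  have "finite G" using assms(3) finite_subset by blast
  have "(\<Sum>j<n. offset d q p m K i j * enc n p m z G j) =
    (\<Sum>j<n. if j < p then 0 else if (j - p) div m \<in> G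
       then (\<lambda>g. if g mod d = i then q * 2 ^ (g div d) else 0) ((j - p) div m) else 0)"
    by (intro sum.cong) (use assms in \<open>auto simp: offset_def enc_def\<close>)
  also have "\<dots> = (\<Sum>j<p. 0) + real m * (\<Sum>g\<in>G. if g mod d = i then q * 2 ^ (g div d) else 0)"
    by (rule sum_blocks) (use assms in auto)
  also have "(\<Sum>g\<in>G. if g mod d = i then q * 2 ^ (g div d) else 0) = q * real (level d G i)"
    using \<open>finite G\<close> by (simp add: level_def sum_distrib_left sum.If_cases Int_def)
  finally show ?thesis by simp
qed

lemma enc_01:
  assumes "z \<in> {..<p} \<rightarrow> {0, 1}" "j < n"
  shows "enc n p m z G j \<in> {0, 1}"
  using assms by (auto simp: enc_def)

lemma sols_subset: "sols n p m K \<subseteq> {..<n} \<rightarrow>\<^sub>E {0, 1}"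
proof
  fix x assume "x \<in> sols n p m K"
  then obtain z G where x: "x = enc n p m z G" and z: "z \<in> {..<p} \<rightarrow> {0, 1}"
    unfolding sols_def by blast
  show "x \<in> {..<n} \<rightarrow>\<^sub>E {0, 1}"
  proof (rule PiE_I)
    fix j assume "j \<in> {..<n}"
    then show "x j \<in> {0, 1}" unfolding x by (intro enc_01[OF z]) simp
  qed (simp add: x enc_def)
qed

lemma thr_01: "thr d l u v \<in> {..<p} \<rightarrow> {0, 1}"
  by (auto simp: thr_def)

text \<open>Each item profit is its left end plus noise in [0, l]. The left ends of the packed items
  add up to a multiple of the level, and their noise to at most \<open>n * l\<close>.\<close>

lemma profit_enc_bounds:
  assumes "m > 0" "p + K * m \<le> n" "G \<subseteq> {..<K}" and z: "z \<in> {..<p} \<rightarrow> {0, 1}"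
    and v: "\<And>j. j < n \<Longrightarrow> v (i, j) \<in> {offset d q p m K i j..offset d q p m K i j + l}"
  shows "real m * q * real (level d G i) \<le> profit n v i (enc n p m z G)"
    and "profit n v i (enc n p m z G) \<le> real m * q * real (level d G i) + real n * l"
proof -
  let ?x = "enc n p m z G" and ?a = "offset d q p m K i"
  have e: "profit n v i ?x = real m * q * real (level d G i) + (\<Sum>j<n. (v (i, j) - ?a j) * ?x j)"
    using sum_offset_enc[OF assms(1-3), of d q i z]
    by (simp add: profit_def left_diff_distrib sum_subtractf)
  have b: "0 \<le> (v (i, j) - ?a j) * ?x j \<and> (v (i, j) - ?a j) * ?x j \<le> l" if "j < n" for j
    using v[OF that] enc_01[OF z that, of m G] by auto
  have "0 \<le> (\<Sum>j<n. (v (i, j) - ?a j) * ?x j)" using b by (intro sum_nonneg) auto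
  moreover have "(\<Sum>j<n. (v (i, j) - ?a j) * ?x j) \<le> (\<Sum>j<n. l)" using b by (intro sum_mono) auto
  ultimately show "real m * q * real (level d G i) \<le> profit n v i ?x"
    "profit n v i ?x \<le> real m * q * real (level d G i) + real n * l"
    by (auto simp: e)
qed

section \<open>Pareto-optimality and counting\<close>

text \<open>A dominating solution must contain the same groups, since the profits bound each of its
  levels from below and the weight bounds their sum from above. Then only base items can differ, and
  on them \<open>thr\<close> maximizes the weighted profits minus the weight, a quantity that
  dominance would strictly increase.\<close>

lemma pareto_enc:
  assumes d: "d > 0" and m: "m > 0" and n: "p + K * m \<le> n" and G: "G \<subseteq> {..<K}"
    and l: "0 < l" "l \<le> 1" and q: "real n * l < real m * q"
    and v: "\<And>i j. i < d \<Longrightarrow> j < n \<Longrightarrow> v (i, j) \<in> {offset d q p m K i j..offset d q p m K i j + l}"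
    and u: "\<And>i. i < d \<Longrightarrow> u i > 0"
  shows "pareto_optimal d n (sols n p m K) (item_weight d l p m) v (enc n p m (thr d l u v) G)"
  unfolding pareto_optimal_def
proof (intro conjI notI)
  let ?w = "item_weight d l p m" and ?x = "enc n p m (thr d l u v) G"
  show "?x \<in> sols n p m K"
    unfolding sols_def using thr_01[of d l u v p] G by blast
  assume "\<exists>y\<in>sols n p m K. dominates d n ?w v y ?x"
  then obtain z H where z: "z \<in> {..<p} \<rightarrow> {0, 1}" and H: "H \<subseteq> {..<K}"
    and dom: "dominates d n ?w v (enc n p m z H) ?x" by (auto simp: sols_def)
  let ?y = "enc n p m z H"
  have pr: "profit n v i ?x \<le> profit n v i ?y" if "i < d" for i
    using dom that by (auto simp: dominates_def)
  have we: "weight n ?w ?y \<le> weight n ?w ?x" using dom by (auto simp: dominates_def)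
  have le: "level d G i \<le> level d H i" if i: "i < d" for i
  proof -
    have "real m * q * real (level d G i) \<le> profit n v i ?x"
      by (rule profit_enc_bounds[OF m n G thr_01 v]) (use i in auto)
    also have "\<dots> \<le> profit n v i ?y" by (rule pr[OF i])
    also have "\<dots> \<le> real m * q * real (level d H i) + real n * l"
      by (rule profit_enc_bounds[OF m n H z v]) (use i in auto)
    \<comment> \<open>The gap \<open>m * q\<close> between consecutive levels exceeds the noise
      \<open>n * l\<close>; integrality then yields the weak inequality of levels.\<close>
    also have "\<dots> < real m * q * (real (level d H i) + 1)" using q by (simp add: algebra_simps)
    finally have "real (level d G i) < real (level d H i) + 1"
      using q l by (subst (asm) mult_less_cancel_left_pos) (auto intro: le_less_trans[rotated])
    then show ?thesis by linarith
  qed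
  have "(\<Sum>i<d. level d H i) \<le> (\<Sum>i<d. level d G i)"
  proof -
    have "real m * (real p + 1) * real (\<Sum>i<d. level d H i) \<le> weight n ?w ?y"
    proof -
      have "0 \<le> (\<Sum>j<p. z j)" 
      proof (rule sum_nonneg)
        fix j assume "j \<in> {..<p}"
        then have "z j \<in> {0, 1}" using z by auto
        then show "0 \<le> z j" by auto
      qed
      then show ?thesis unfolding weight_enc[OF d m n H] using l by simp
    qed
    also note we
    also have "weight n ?w ?x \<le> real p + real m * (real p + 1) * real (\<Sum>i<d. level d G i)"
    proof -
      have "l * (\<Sum>j<p. thr d l u v j) \<le> 1 * (\<Sum>j<p. 1)"
        using l by (intro mult_mono sum_mono sum_nonneg) (auto simp: thr_def)
      then show ?thesis unfolding weight_enc[OF d m n G] by simp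
    qed
    \<comment> \<open>The base items weigh at most \<open>p\<close>, less than the weight
      \<open>m * (p + 1)\<close> of one level unit.\<close>
    also have "\<dots> < real m * (real p + 1) * (real (\<Sum>i<d. level d G i) + 1)"
    proof -
      have "1 * (real p + 1) \<le> real m * (real p + 1)" using m by (intro mult_right_mono) auto
      then show ?thesis by (simp add: algebra_simps)
    qed
    finally have "real (\<Sum>i<d. level d H i) < real (\<Sum>i<d. level d G i) + 1"
      using m by (subst (asm) mult_less_cancel_left_pos) auto
    then show ?thesis by linarith
  qed
  moreover have "(\<Sum>i<d. level d G i) \<le> (\<Sum>i<d. level d H i)" using le by (intro sum_mono) auto
  ultimately have "(\<Sum>i<d. level d G i) = (\<Sum>i<d. level d H i)" by simp
  then have "level d G i = level d H i" if "i < d" for i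
    by (rule sum_mono_inv) (use le that in auto)
  then have GH: "G = H"
    using G H finite_subset by (intro level_inj[OF d]) blast+
  \<comment> \<open>Scalarization by the positive multipliers \<open>u\<close>. It splits into a sum
    over items, so maximality can be checked item by item.\<close>
  define F where "F = (\<lambda>x. (\<Sum>i<d. u i * profit n v i x) - weight n ?w x)"
  have F: "F x = (\<Sum>j<n. ((\<Sum>i<d. u i * v (i, j)) - ?w j) * x j)" for x
  proof -
    have "(\<Sum>i<d. u i * profit n v i x) = (\<Sum>i<d. \<Sum>j<n. u i * v (i, j) * x j)"
      by (simp add: profit_def sum_distrib_left mult.assoc)
    also have "\<dots> = (\<Sum>j<n. \<Sum>i<d. u i * v (i, j) * x j)" by (rule sum.swap)
    finally show ?thesis
      by (simp add: F_def weight_def sum_subtractf[symmetric] sum_distrib_right left_diff_distrib)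
  qed
  have "F ?y \<le> F ?x" unfolding F
  proof (intro sum_mono)
    fix j assume j: "j \<in> {..<n}"
    show "((\<Sum>i<d. u i * v (i, j)) - ?w j) * ?y j \<le> ((\<Sum>i<d. u i * v (i, j)) - ?w j) * ?x j"
    proof (cases "j < p")
      case True
      \<comment> \<open>The coefficient of a base item is its weighted profit minus
        \<open>l\<close>, and \<open>thr\<close> packs the item exactly if this is positive.\<close>
      then have "z j \<in> {0, 1}" using z by auto
      then show ?thesis using True j by (auto simp: enc_def item_weight_def thr_def)
    next
      case False
      then show ?thesis using j by (simp add: enc_def GH)
    qed
  qed
  \<comment> \<open>All \<open>u i\<close> are positive, so a strict gain in the weight or in any
    single profit is a strict gain in \<open>F\<close>.\<close>
  moreover have "F ?x < F ?y"
  proof -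
    have le: "(\<Sum>i<d. u i * profit n v i ?x) \<le> (\<Sum>i<d. u i * profit n v i ?y)"
      using pr u by (intro sum_mono mult_left_mono) (auto simp: less_imp_le)
    from dom consider "weight n ?w ?y < weight n ?w ?x"
      | i where "i < d" "profit n v i ?x < profit n v i ?y" by (auto simp: dominates_def)
    then show ?thesis
    proof cases
      case 1
      then show ?thesis using le by (simp add: F_def)
    next
      case 2
      have "(\<Sum>i<d. u i * profit n v i ?x) < (\<Sum>i<d. u i * profit n v i ?y)"
        using pr u 2 by (intro sum_strict_mono_ex1) (auto intro!: mult_left_mono bexI[of _ i] simp: less_imp_le)
      then show ?thesis using we by (simp add: F_def)
    qed
  qed
  ultimately show False by simp
qed

lemma finite_cube_subset:
  fixes n :: nat
  assumes "S \<subseteq> {..<n} \<rightarrow>\<^sub>E {0, 1 :: real}"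
  shows "finite S"
  using assms by (rule finite_subset) (intro finite_PiE, auto)

text \<open>The map from pairs of multiplier index and group set to solutions is injective: the
  items below \<open>p\<close> identify \<open>z\<close> by \<open>inj\<close>, the later items
  identify the group set. Every image is Pareto-optimal by \<open>pareto_enc\<close>.\<close>

lemma num_pareto_ge:
  assumes d: "d > 0" and m: "m > 0" and n: "p + K * m \<le> n"
    and l: "0 < l" "l \<le> 1" and q: "real n * l < real m * q"
    and v: "\<And>i j. i < d \<Longrightarrow> j < n \<Longrightarrow> v (i, j) \<in> {offset d q p m K i j..offset d q p m K i j + l}"
    and u: "\<And>z i. z \<in> Z \<Longrightarrow> i < d \<Longrightarrow> u z i > 0"
    and inj: "\<And>z z'. z \<in> Z \<Longrightarrow> z' \<in> Z \<Longrightarrow> z \<noteq> z' \<Longrightarrow> \<exists>j<p. thr d l (u z) v j \<noteq> thr d l (u z') v j"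
  shows "card Z * 2 ^ K \<le> num_pareto d n (sols n p m K) (item_weight d l p m) v"
proof -
  define f where "f = (\<lambda>(z, G). enc n p m (thr d l (u z) v) G)"
  have "inj_on f (Z \<times> Pow {..<K})"
  proof (intro inj_onI, clarify)
    fix z G z' G' assume z: "z \<in> Z" "z' \<in> Z" and G: "G \<subseteq> {..<K}" "G' \<subseteq> {..<K}"
      and eq: "f (z, G) = f (z', G')"
    have e: "enc n p m (thr d l (u z) v) G j = enc n p m (thr d l (u z') v) G' j" for j
      using eq by (simp add: f_def)
    have "thr d l (u z) v j = thr d l (u z') v j" if "j < p" for j
      using e[of j] that n by (simp add: enc_def)
    then have "z = z'" using inj[OF z] by blast
    have "g \<in> G \<longleftrightarrow> g \<in> G'" if "g < K" for g
    proof -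
      \<comment> \<open>The first item of group \<open>g\<close> has index
        \<open>p + g * m < n\<close>, and its value shows whether the group is packed.\<close>
      have "Suc g * m \<le> K * m" using that by (intro mult_right_mono) auto
      then have "p + g * m < n" using n m by simp
      then show ?thesis using e[of "p + g * m"] m by (simp add: enc_def split: if_splits)
    qed
    then show "z = z' \<and> G = G'" using G \<open>z = z'\<close> by blast
  qed
  then have "card Z * 2 ^ K = card (f ` (Z \<times> Pow {..<K}))"
    by (simp add: card_image card_cartesian_product card_Pow)
  also have "\<dots> \<le> num_pareto d n (sols n p m K) (item_weight d l p m) v"
    unfolding num_pareto_def
  proof (rule card_mono)
    show "finite {x. pareto_optimal d n (sols n p m K) (item_weight d l p m) v x}"
      by (rule finite_subset[OF _ finite_cube_subset[OF sols_subset]])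
        (auto simp: pareto_optimal_def)
    show "f ` (Z \<times> Pow {..<K}) \<subseteq> {x. pareto_optimal d n (sols n p m K) (item_weight d l p m) v x}"
    proof (intro image_subsetI)
      fix zG assume "zG \<in> Z \<times> Pow {..<K}"
      then obtain z G where zG: "zG = (z, G)" "z \<in> Z" "G \<subseteq> {..<K}" by blast
      have "pareto_optimal d n (sols n p m K) (item_weight d l p m) v (enc n p m (thr d l (u z) v) G)"
        by (rule pareto_enc[OF d m n zG(3) l q v u[OF zG(2)]])
      then show "f zG \<in> {x. pareto_optimal d n (sols n p m K) (item_weight d l p m) v x}"
        by (simp add: f_def zG)
    qed
  qed
  finally show ?thesis .
qed

section \<open>Passage to the expectation\<close>

text \<open>The count is a finite sum of indicators of measurable events. Integrability matters
  because the Bochner integral of a nonintegrable function is 0, which would destroy any lower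
  bound.\<close>

lemma integrable_num_pareto:
  assumes l: "l > 0" and S: "finite S"
  shows "integrable (profit_distr d n a (\<lambda>i j. a i j + l)) (\<lambda>v. real (num_pareto d n S w v))"
proof -
  define P where "P = PiM ({..<d} \<times> {..<n}) (factor a l)"
  interpret prob_space P unfolding P_def by (intro prob_space_PiM prob_space_factor l)
  have comp: "(\<lambda>v. v (i, j)) \<in> borel_measurable P" if "i < d" "j < n" for i j
    unfolding P_def using that by (intro coordinate_measurable) auto
  have prof: "(\<lambda>v. profit n v i x) \<in> borel_measurable P" if "i < d" for i x
    unfolding profit_def using comp that by (intro borel_measurable_sum borel_measurable_times) auto
  have dom: "{v\<in>space P. dominates d n w v y x} \<in> sets P" for x y
  proof -
    have all: "{v\<in>space P. \<forall>i\<in>{..<d}. profit n v i x \<le> profit n v i y} \<in> sets P"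
      by (rule sets.sets_Collect_finite_All) (auto intro!: borel_measurable_le prof)
    have ex: "{v\<in>space P. \<exists>i\<in>{..<d}. profit n v i x < profit n v i y} \<in> sets P"
      by (rule sets.sets_Collect_finite_Ex) (auto intro!: borel_measurable_less prof)
    have "{v\<in>space P. weight n w y \<le> weight n w x \<and>
      (\<forall>i\<in>{..<d}. profit n v i x \<le> profit n v i y) \<and>
       (weight n w y < weight n w x \<or> (\<exists>i\<in>{..<d}. profit n v i x < profit n v i y))} \<in> sets P"
      using all ex sets.sets_Collect_conj[OF all ex] sets.sets_Collect_conj[OF ex all]
      by (cases "weight n w y \<le> weight n w x"; cases "weight n w y < weight n w x") simp_all
    then show ?thesis by (simp only: dominates_def Ball_def Bex_def lessThan_iff)
  qed
  have par: "{v\<in>space P. pareto_optimal d n S w v x} \<in> sets P" for x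
  proof -
    have "{v\<in>space P. \<not> (\<exists>y\<in>S. dominates d n w v y x)} \<in> sets P"
      by (intro sets.sets_Collect_neg sets.sets_Collect_finite_Ex dom S)
    then show ?thesis by (cases "x \<in> S") (simp_all add: pareto_optimal_def)
  qed
  have eq: "real (num_pareto d n S w v) = (\<Sum>x\<in>S. indicator {v\<in>space P. pareto_optimal d n S w v x} v)"
    if "v \<in> space P" for v
  proof -
    have "{x. pareto_optimal d n S w v x} = {x\<in>S. pareto_optimal d n S w v x}"
      by (auto simp: pareto_optimal_def)
    then show ?thesis using S that
      by (simp add: num_pareto_def indicator_def sum.If_cases Int_def)
  qed
  have "integrable P (\<lambda>v. real (num_pareto d n S w v)) \<longleftrightarrow>
    integrable P (\<lambda>v. \<Sum>x\<in>S. indicator {v\<in>space P. pareto_optimal d n S w v x} v :: real)"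
    using eq by (intro Bochner_Integration.integrable_cong) auto
  moreover have "integrable P (\<lambda>v. \<Sum>x\<in>S. indicator {v\<in>space P. pareto_optimal d n S w v x} v :: real)"
    using par by (intro Bochner_Integration.integrable_sum) (auto simp: emeasure_eq_measure)
  ultimately show ?thesis by (simp add: profit_distr_eq P_def)
qed

text \<open>Markov's inequality, from the almost sure bound of the count below by \<open>N\<close>
  times the indicator of \<open>E\<close>. The bound \<open>ge\<close> may assume that the profits
  lie in their intervals, since this holds almost surely.\<close>

lemma integral_num_pareto_ge:
  assumes l: "l > 0" and S: "finite S" and N: "N \<ge> 0"
    and E: "E \<in> sets (profit_distr d n a (\<lambda>i j. a i j + l))"
    and ge: "\<And>v. v \<in> E \<Longrightarrow> (\<And>i j. i < d \<Longrightarrow> j < n \<Longrightarrow> v (i, j) \<in> {a i j..a i j + l}) \<Longrightarrow>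
      N \<le> real (num_pareto d n S w v)"
  shows "N * measure (profit_distr d n a (\<lambda>i j. a i j + l)) E
    \<le> (\<integral>v. real (num_pareto d n S w v) \<partial>profit_distr d n a (\<lambda>i j. a i j + l))"
proof -
  define P where "P = profit_distr d n a (\<lambda>i j. a i j + l)"
  have P: "P = PiM ({..<d} \<times> {..<n}) (factor a l)" by (simp add: P_def profit_distr_eq)
  interpret prob_space P unfolding P by (intro prob_space_PiM prob_space_factor l)
  have EP: "E \<in> sets P" using E by (simp add: P_def)
  have "AE v in P. \<forall>(i, j)\<in>{..<d} \<times> {..<n}. v (i, j) \<in> {a i j..a i j + l}"
    unfolding P by (rule AE_box[OF l]) auto
  then have ae: "AE v in P. N * indicator E v \<le> real (num_pareto d n S w v)"
  proof eventually_elim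
    case (elim v)
    then show ?case using ge[of v] N by (cases "v \<in> E") auto
  qed
  have "N * prob E = (\<integral>v. N * indicator E v \<partial>P)" using EP by simp
  also have "\<dots> \<le> (\<integral>v. real (num_pareto d n S w v) \<partial>P)"
    using ae EP integrable_num_pareto[OF l S, of d n a w]
    by (intro integral_mono_AE) (auto simp: P_def[symmetric] emeasure_eq_measure)
  finally show ?thesis by (simp add: P_def)
qed

section \<open>Choice of parameters\<close>

lemma prob_space_profit_distr:
  assumes "l > 0"
  shows "prob_space (profit_distr d n a (\<lambda>i j. a i j + l))"
  unfolding profit_distr_eq by (intro prob_space_PiM prob_space_factor assms)

text \<open>The conclusion of the theorem for one lower bound \<open>x\<close>, so that each range
  of \<open>n\<close> and \<open>\<phi>\<close> can supply its own instance and then weaken the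
  bound.\<close>

definition achievable :: "nat \<Rightarrow> nat \<Rightarrow> real \<Rightarrow> real \<Rightarrow> bool" where
  "achievable d n \<phi> x \<longleftrightarrow> (\<exists>w a b S. (\<forall>j<n. w j \<ge> 0) \<and>
     (\<forall>i<d. \<forall>j<n. 0 \<le> a i j \<and> a i j \<le> b i j \<and> b i j \<le> 1 \<and> b i j - a i j \<ge> 1 / \<phi>) \<and>
     S \<subseteq> ({..<n} \<rightarrow>\<^sub>E {0, 1}) \<and>
     (\<integral>v. real (num_pareto d n S w v) \<partial>profit_distr d n a b) \<ge> x)"

lemma achievableI:
  assumes "\<And>j. j < n \<Longrightarrow> w j \<ge> 0"
    and "\<And>i j. i < d \<Longrightarrow> j < n \<Longrightarrow> 0 \<le> a i j \<and> a i j + l \<le> 1"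
    and "l \<ge> 1 / \<phi>" "l > 0" and "S \<subseteq> {..<n} \<rightarrow>\<^sub>E {0, 1}"
    and "x \<le> (\<integral>v. real (num_pareto d n S w v) \<partial>profit_distr d n a (\<lambda>i j. a i j + l))"
  shows "achievable d n \<phi> x"
  unfolding achievable_def
proof (rule exI[of _ w], rule exI[of _ a], rule exI[of _ "\<lambda>i j. a i j + l"], rule exI[of _ S],
    intro conjI)
  show "\<forall>j<n. 0 \<le> w j" using assms(1) by simp
  show "\<forall>i<d. \<forall>j<n. 0 \<le> a i j \<and> a i j \<le> a i j + l \<and> a i j + l \<le> 1 \<and>
    1 / \<phi> \<le> a i j + l - a i j"
    using assms(2-4) by simp
qed (fact assms(5), fact assms(6))

lemma achievable_mono: "achievable d n \<phi> x \<Longrightarrow> y \<le> x \<Longrightarrow> achievable d n \<phi> y"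
proof -
  assume le: "y \<le> x" and "achievable d n \<phi> x"
  then obtain w a b S where *: "\<forall>j<n. w j \<ge> 0"
    "\<forall>i<d. \<forall>j<n. 0 \<le> a i j \<and> a i j \<le> b i j \<and> b i j \<le> 1 \<and> b i j - a i j \<ge> 1 / \<phi>"
    "S \<subseteq> {..<n} \<rightarrow>\<^sub>E {0, 1}"
    and ge: "(\<integral>v. real (num_pareto d n S w v) \<partial>profit_distr d n a b) \<ge> x"
    unfolding achievable_def by (elim exE conjE) (rule that)
  from le ge have "(\<integral>v. real (num_pareto d n S w v) \<partial>profit_distr d n a b) \<ge> y"
    by (rule order_trans)
  with * show ?thesis unfolding achievable_def
    by - (rule exI[of _ w], rule exI[of _ a], rule exI[of _ b], rule exI[of _ S], intro conjI)
qed

text \<open>On an event of probability at least 1/2 all \<open>R ^ (d - 1)\<close> base packings are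
  distinct, and each is combined with \<open>2 ^ (k * d)\<close> group sets. The condition on
  \<open>k\<close> keeps all intervals inside [0, 1]; for \<open>k = 0\<close> there are no groups
  and every left end is 0.\<close>

lemma expected_pareto_ge:
  assumes d: "d \<ge> 2" and n: "n \<ge> 1" and \<phi>: "\<phi> > 1" and m: "m > 0"
    and sz: "p + k * d * m \<le> n" and R: "R > 0"
    and small: "(real R ^ (d - 1))\<^sup>2 * exp (- real p / (16 * real d * real R)) \<le> 1 / 2"
    and k: "k = 0 \<or> 2 * real n / (real m * \<phi>) * 2 ^ k + 1 / \<phi> \<le> 1"
  shows "achievable d n \<phi> (real R ^ (d - 1) * 2 ^ (k * d) / 2)"
proof -
  define l where "l = 1 / \<phi>"
  have l: "0 < l" "l \<le> 1" using \<phi> by (auto simp: l_def)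
  \<comment> \<open>This makes \<open>m * q\<close> twice the total noise \<open>n * l\<close>,
    hence strictly larger.\<close>
  define q where "q = 2 * real n / (real m * \<phi>)"
  have q0: "q \<ge> 0" using \<phi> by (simp add: q_def)
  have q: "real n * l < real m * q" using n m \<phi> by (simp add: q_def l_def field_simps)
  define a where "a = offset d q p m (k * d)"
  define w where "w = item_weight d l p m"
  define S where "S = sols n p m (k * d)"
  define G where "G = {..<d - 1} \<rightarrow>\<^sub>E {..<R}"
  define P where "P = profit_distr d n a (\<lambda>i j. a i j + l)"
  have a_le: "a i j + l \<le> 1" for i j
  proof (cases "p \<le> j \<and> (j - p) div m < k * d \<and> (j - p) div m mod d = i")
    case True
    then have "(j - p) div m div d < k" by (simp add: less_mult_imp_div_less)
    then have "q * 2 ^ ((j - p) div m div d) \<le> q * 2 ^ k"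
      using q0 by (intro mult_left_mono power_increasing) auto
    moreover have "q * 2 ^ k + l \<le> 1"
      using k \<open>(j - p) div m div d < k\<close> by (auto simp: q_def l_def)
    ultimately show ?thesis using True by (simp add: a_def offset_def)
  qed (use l in \<open>auto simp: a_def offset_def\<close>)
  have a_ge: "0 \<le> a i j" for i j using q0 by (simp add: a_def offset_def)
  have a0: "a i j = 0" if "i < d" "j < p" for i j using that by (simp add: a_def offset_def)
  have pn: "p \<le> n" using sz by simp
  have "\<exists>E\<in>sets P. 1 / 2 \<le> measure P E \<and>
    (\<forall>v\<in>E. \<forall>z\<in>G. \<forall>z'\<in>G. z \<noteq> z' \<longrightarrow>
       (\<exists>j<p. thr d l (lam d R z) v j \<noteq> thr d l (lam d R z') v j))"
    unfolding P_def profit_distr_eq G_def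
    using thr_inj_prob[OF d l(1) R pn a0 small] .
  then obtain E where E: "E \<in> sets P" "1 / 2 \<le> measure P E"
    and inj: "\<forall>v\<in>E. \<forall>z\<in>G. \<forall>z'\<in>G. z \<noteq> z' \<longrightarrow>
      (\<exists>j<p. thr d l (lam d R z) v j \<noteq> thr d l (lam d R z') v j)"
    by (elim bexE conjE) (rule that)
  have d0: "d > 0" using d by simp
  have lam0: "0 < lam d R z i" for z i using d R by (simp add: lam_def)
  define N where "N = real R ^ (d - 1) * 2 ^ (k * d)"
  have "N * (1 / 2) \<le> N * measure P E"
    using E by (intro mult_left_mono) (auto simp: N_def)
  also have "\<dots> \<le> (\<integral>v. real (num_pareto d n S w v) \<partial>P)"
    unfolding P_def
  proof (rule integral_num_pareto_ge)
    show "finite S" unfolding S_def by (rule finite_cube_subset[OF sols_subset])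
    show "E \<in> sets (profit_distr d n a (\<lambda>i j. a i j + l))" using E by (simp add: P_def)
    fix v assume v: "v \<in> E" and box: "\<And>i j. i < d \<Longrightarrow> j < n \<Longrightarrow> v (i, j) \<in> {a i j..a i j + l}"
    have "card G * 2 ^ (k * d) \<le> num_pareto d n S w v"
      unfolding S_def w_def
      by (rule num_pareto_ge[OF d0 m sz l q box[unfolded a_def] lam0 inj[rule_format, OF v]])
    moreover have "card G = R ^ (d - 1)" by (simp add: G_def card_PiE)
    ultimately have "R ^ (d - 1) * 2 ^ (k * d) \<le> num_pareto d n S w v" by simp
    then have "real (R ^ (d - 1) * 2 ^ (k * d)) \<le> real (num_pareto d n S w v)"
      by (rule of_nat_mono)
    then show "N \<le> real (num_pareto d n S w v)" by (simp add: N_def)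
  qed (use l in \<open>auto simp: N_def\<close>)
  finally have "N / 2 \<le> (\<integral>v. real (num_pareto d n S w v) \<partial>profit_distr d n a (\<lambda>i j. a i j + l))"
    by (simp add: P_def)
  moreover have "S \<subseteq> {..<n} \<rightarrow>\<^sub>E {0, 1}" unfolding S_def by (rule sols_subset)
  moreover have "w j \<ge> 0" for j using l by (simp add: w_def item_weight_def)
  ultimately show ?thesis using a_le a_ge l
    by (intro achievableI[of n w d a l \<phi> S]) (auto simp: N_def l_def)
qed

text \<open>Serves small \<open>n\<close>, where the target is at most 2. The empty solution and a
  single item of weight 1 do not dominate each other, because the left ends \<open>1 - l > 0\<close>
  make all profits of the item positive.\<close>

lemma expected_pareto_ge_2:
  assumes d: "d \<ge> 1" and n: "n \<ge> 1" and \<phi>: "\<phi> > 1"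
  shows "achievable d n \<phi> (2)"
proof -
  define l where "l = 1 / \<phi>"
  have l: "0 < l" "l < 1" using \<phi> by (auto simp: l_def)
  define w where "w = (\<lambda>j :: nat. 1 :: real)"
  define a where "a = (\<lambda>(i :: nat) (j :: nat). 1 - l)"
  define x where "x = (\<lambda>j\<in>{..<n}. 0 :: real)"
  define y where "y = (\<lambda>j\<in>{..<n}. if j = 0 then 1 else 0 :: real)"
  define P where "P = profit_distr d n a (\<lambda>i j. a i j + l)"
  interpret prob_space P unfolding P_def
    by (rule prob_space_profit_distr[OF l(1)])
  have wx: "weight n w x = 0" and px: "profit n v i x = 0" for v i
    by (simp_all add: weight_def profit_def x_def)
  have y0: "(\<Sum>j<n. f j * y j) = f 0" for f
  proof -
    have "(\<Sum>j<n. f j * y j) = (\<Sum>j<n. if j = 0 then f j else 0)"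
      by (intro sum.cong) (auto simp: y_def)
    also have "\<dots> = f 0" using n by simp
    finally show ?thesis .
  qed
  have wy: "weight n w y = 1" and py: "profit n v i y = v (i, 0)" for v i
    unfolding weight_def profit_def y0 by (simp_all add: w_def)
  have "2 * measure P (space P) \<le> (\<integral>v. real (num_pareto d n {x, y} w v) \<partial>P)"
    unfolding P_def
  proof (rule integral_num_pareto_ge)
    fix v assume box: "\<And>i j. i < d \<Longrightarrow> j < n \<Longrightarrow> v (i, j) \<in> {a i j..a i j + l}"
    have v: "v (i, 0) > 0" if "i < d" for i
      using box[OF that, of 0] n l by (auto simp: a_def)
    have "x \<noteq> y" using wx wy by auto
    have "{v'. pareto_optimal d n {x, y} w v v'} = {x, y}"
      using v d by (auto simp: pareto_optimal_def dominates_def wx wy px py not_le intro!: exI[of _ 0])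
    then show "2 \<le> real (num_pareto d n {x, y} w v)"
      using \<open>x \<noteq> y\<close> by (simp add: num_pareto_def)
  qed (use l in auto)
  moreover have "{x, y} \<subseteq> {..<n} \<rightarrow>\<^sub>E {0, 1}" by (auto simp: x_def y_def)
  ultimately show ?thesis using l prob_space
    by (intro achievableI[of n w d a l \<phi> "{x, y}"]) (auto simp: P_def a_def w_def l_def)
qed

section \<open>Asymptotic choice of the grid and of the groups\<close>

text \<open>Let \<open>p = n div 2\<close> and \<open>R\<close> be about
  \<open>p powr (1 - \<beta>)\<close>; since \<open>(1 - \<beta>) * (d - 1) = d - 3/2\<close>, the
  grid has the desired size. Then \<open>p / R\<close> is at least \<open>p powr \<beta>\<close>,
  and the exponential decay beats the squared polynomial.\<close>

lemma grid_size:
  assumes d: "d \<ge> 2"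
  shows "\<exists>c>0. \<exists>n0. \<forall>n\<ge>n0. \<exists>R>0.
    (real R ^ (d - 1))\<^sup>2 * exp (- real (n div 2) / (16 * real d * real R)) \<le> 1 / 2 \<and>
    c * real n powr (real d - 3/2) \<le> real R ^ (d - 1)"
proof -
  define \<beta> where "\<beta> = 1 / (2 * (real d - 1))"
  define e where "e = real d - 3/2"
  have \<beta>: "0 < \<beta>" "\<beta> \<le> 1 / 2" and e: "e > 0"
    using d by (auto simp: \<beta>_def e_def field_simps)
  have \<beta>e: "(1 - \<beta>) * real (d - 1) = e"
    using d by (simp add: \<beta>_def e_def of_nat_diff field_simps)
  define t where "t = 1 / (16 * real d)"
  have t: "t > 0" using d by (simp add: t_def)
  have "((\<lambda>x::real. x powr (2 * e) * exp (- (t * x powr \<beta>))) \<longlongrightarrow> 0) at_top"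
    using t \<beta> e by real_asymp
  then have "eventually (\<lambda>x::real. x powr (2 * e) * exp (- (t * x powr \<beta>)) < 1 / 2) at_top"
    by (rule order_tendstoD) simp
  then obtain X where X: "\<And>x. x \<ge> X \<Longrightarrow> x powr (2 * e) * exp (- (t * x powr \<beta>)) < 1 / 2"
    by (auto simp: eventually_at_top_linorder)
  \<comment> \<open>The factor \<open>1 / 4\<close> pays for \<open>n \<le> 4 * (n div 2)\<close>,
    each \<open>1 / 2\<close> for rounding \<open>p powr (1 - \<beta>)\<close> down to
    \<open>R\<close>.\<close>
  define c where "c = (1 / 4) powr e * (1 / 2) ^ (d - 1)"
  have "\<exists>R>0. (real R ^ (d - 1))\<^sup>2 * exp (- real (n div 2) / (16 * real d * real R)) \<le> 1 / 2 \<and>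
    c * real n powr e \<le> real R ^ (d - 1)" if n: "n \<ge> 2 * nat \<lceil>X\<rceil> + 2" for n
  proof -
    define p where "p = real (n div 2)"
    have "nat \<lceil>X\<rceil> \<le> n div 2" "1 \<le> n div 2" "n \<le> 4 * (n div 2)" using n by linarith+
    then have p: "p \<ge> X" "p \<ge> 1" "real n / 4 \<le> p" unfolding p_def by linarith+
    define R where "R = nat \<lfloor>p powr (1 - \<beta>)\<rfloor>"
    have p1: "1 \<le> p powr (1 - \<beta>)" using p \<beta> by (simp add: ge_one_powr_ge_zero)
    then have "1 \<le> \<lfloor>p powr (1 - \<beta>)\<rfloor>" by simp
    then have R: "real R = of_int \<lfloor>p powr (1 - \<beta>)\<rfloor>" "1 \<le> real R"
      unfolding R_def by linarith+
    have R1: "R > 0" "real R \<le> p powr (1 - \<beta>)" "p powr (1 - \<beta>) / 2 \<le> real R"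
      using R by linarith+
    have pe: "(p powr (1 - \<beta>)) ^ (d - 1) = p powr e"
      using p \<beta>e by (simp add: powr_realpow[symmetric] powr_powr)
    have "(real R ^ (d - 1))\<^sup>2 \<le> (p powr e)\<^sup>2"
      unfolding pe[symmetric] using R1 by (intro power_mono) auto
    also have "\<dots> = p powr (2 * e)" using p by (simp add: powr_realpow[symmetric] powr_powr mult.commute)
    finally have R2: "(real R ^ (d - 1))\<^sup>2 \<le> p powr (2 * e)" .
    have "p powr \<beta> * real R \<le> p powr \<beta> * p powr (1 - \<beta>)"
      using R1 by (intro mult_left_mono) auto
    also have "\<dots> = p" using p by (simp add: powr_add[symmetric])
    finally have "t * p powr \<beta> \<le> p / (16 * real d * real R)"
      using R1 d by (simp add: t_def field_simps)
    then have "exp (- p / (16 * real d * real R)) \<le> exp (- (t * p powr \<beta>))" by simp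
    with R2 have "(real R ^ (d - 1))\<^sup>2 * exp (- p / (16 * real d * real R))
      \<le> p powr (2 * e) * exp (- (t * p powr \<beta>))" by (intro mult_mono) auto
    also have "\<dots> \<le> 1 / 2" using X[OF p(1)] by simp
    finally have 1: "(real R ^ (d - 1))\<^sup>2 * exp (- p / (16 * real d * real R)) \<le> 1 / 2" .
    have "c * real n powr e = (real n / 4) powr e * (1 / 2) ^ (d - 1)"
      by (simp add: c_def powr_divide)
    also have "\<dots> \<le> p powr e * (1 / 2) ^ (d - 1)"
      using p e by (intro mult_right_mono powr_mono2) auto
    also have "\<dots> = (p powr (1 - \<beta>) / 2) ^ (d - 1)" by (simp add: pe[symmetric] power_divide)
    also have "\<dots> \<le> real R ^ (d - 1)" using R1 by (intro power_mono) auto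
    finally show ?thesis using 1 R1 by (auto simp: p_def)
  qed
  moreover have "c > 0" by (simp add: c_def)
  ultimately show ?thesis unfolding e_def by blast
qed

text \<open>About \<open>\<gamma> * log 2 \<phi>\<close> bits per profit make
  \<open>2 ^ (k * d)\<close> of order \<open>\<phi> powr (d - 1)\<close>, as
  \<open>\<gamma> * d = d - 1\<close>. With half of the items spent on groups, \<open>n / m\<close>
  is at most \<open>4 * d * k\<close>; the offsets fit because \<open>k * 2 ^ k\<close> is at most
  \<open>log 2 \<phi> * \<phi> powr \<gamma>\<close>, which is small against
  \<open>\<phi>\<close>.\<close>

lemma clone_parameters:
  assumes d: "d \<ge> 2"
  shows "\<exists>C\<ge>4. \<forall>\<phi>>C. \<forall>n\<ge>4 * d. \<exists>k m. m > 0 \<and> n div 2 + k * d * m \<le> n \<and>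
    2 * real n / (real m * \<phi>) * 2 ^ k + 1 / \<phi> \<le> 1 \<and>
    (\<phi> powr (real d - 1) / 2 ^ d \<le> 2 ^ (k * d) \<or> real n / 4 \<le> real (k * d))"
proof -
  define \<gamma> where "\<gamma> = 1 - 1 / real d"
  have \<gamma>: "1 / 2 \<le> \<gamma>" "\<gamma> < 1" using d by (auto simp: \<gamma>_def field_simps)
  have "((\<lambda>x::real. log 2 x * x powr \<gamma> / x) \<longlongrightarrow> 0) at_top" using \<gamma> by real_asymp
  then have "eventually (\<lambda>x::real. log 2 x * x powr \<gamma> / x < 1 / (16 * real d)) at_top"
    using d by (intro order_tendstoD) auto
  then obtain X where X: "\<And>x. x \<ge> X \<Longrightarrow> log 2 x * x powr \<gamma> / x < 1 / (16 * real d)"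
    by (auto simp: eventually_at_top_linorder)
  have "\<exists>k m. m > 0 \<and> n div 2 + k * d * m \<le> n \<and>
    2 * real n / (real m * \<phi>) * 2 ^ k + 1 / \<phi> \<le> 1 \<and>
    (\<phi> powr (real d - 1) / 2 ^ d \<le> 2 ^ (k * d) \<or> real n / 4 \<le> real (k * d))"
    if \<phi>: "\<phi> > max 4 X" and n: "n \<ge> 4 * d" for \<phi> n
  proof -
    define k0 where "k0 = nat \<lfloor>\<gamma> * log 2 \<phi>\<rfloor>"
    \<comment> \<open>The cap leaves at least one item per group. If it binds, \<open>k * d\<close>
      is linear in \<open>n\<close>, which is the second alternative.\<close>
    define k where "k = min k0 (n div (2 * d))"
    define m where "m = n div (2 * d * k)"
    have "log 2 4 \<le> log 2 \<phi>" using \<phi> by (intro log_mono) auto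
    moreover have "log 2 4 = (2 :: real)" using log_pow_cancel[of 2 2] by simp
    ultimately have lg: "2 \<le> log 2 \<phi>" by simp
    have "1 / 2 * 2 \<le> \<gamma> * log 2 \<phi>" using lg \<gamma> by (intro mult_mono) auto
    then have k0: "1 \<le> k0" "real k0 \<le> \<gamma> * log 2 \<phi>" "\<gamma> * log 2 \<phi> - 1 \<le> real k0"
      unfolding k0_def by linarith+
    have nd: "1 \<le> n div (2 * d)" using n d by (simp add: less_eq_div_iff_mult_less_eq)
    have k1: "1 \<le> k" using k0 nd by (simp add: k_def)
    have kn: "k * (2 * d) \<le> n"
    proof -
      have "k * (2 * d) \<le> n div (2 * d) * (2 * d)" unfolding k_def by (intro mult_right_mono) auto
      also have "\<dots> \<le> n" by (rule div_times_less_eq_dividend)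
      finally show ?thesis .
    qed
    have D: "2 * d * k > 0" using k1 d by simp
    have m1: "1 \<le> m" using kn D by (simp add: m_def less_eq_div_iff_mult_less_eq mult.commute)
    have mn: "m * (2 * d * k) \<le> n" unfolding m_def by (rule div_times_less_eq_dividend)
    have nm: "real n \<le> 4 * real d * real k * real m"
    proof -
      have "n < (m + 1) * (2 * d * k)"
        unfolding m_def using D by (metis Suc_eq_plus1 dividend_less_div_times add.commute mult_Suc)
      also have "\<dots> \<le> (2 * m) * (2 * d * k)" using m1 by (intro mult_right_mono) auto
      finally have "n \<le> 4 * d * k * m" by (simp add: algebra_simps)
      then have "real n \<le> real (4 * d * k * m)" by (rule of_nat_mono)
      then show ?thesis by simp
    qed
    have "n div 2 + k * d * m \<le> n"
    proof -
      have "2 * (k * d * m) \<le> n" using mn by (simp add: algebra_simps)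
      then show ?thesis by linarith
    qed
    moreover have "2 * real n / (real m * \<phi>) * 2 ^ k + 1 / \<phi> \<le> 1"
    proof -
      have pk: "2 ^ k0 \<le> \<phi> powr \<gamma>"
      proof -
        have "(2::real) ^ k0 = 2 powr real k0" by (simp add: powr_realpow)
        also have "\<dots> \<le> 2 powr (\<gamma> * log 2 \<phi>)" using k0 by (intro powr_mono) auto
        also have "\<dots> = (2 powr log 2 \<phi>) powr \<gamma>" by (simp only: powr_powr mult.commute)
        also have "\<dots> = \<phi> powr \<gamma>" using \<phi> by simp
        finally show ?thesis .
      qed
      have "real k * 2 ^ k \<le> real k0 * 2 ^ k0"
        by (intro mult_mono power_increasing) (auto simp: k_def)
      also have "\<dots> \<le> log 2 \<phi> * \<phi> powr \<gamma>"
      proof (intro mult_mono pk)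
        have "\<gamma> * log 2 \<phi> \<le> 1 * log 2 \<phi>" using \<gamma> lg by (intro mult_right_mono) auto
        then show "real k0 \<le> log 2 \<phi>" using k0 by simp
      qed (use lg in auto)
      also have "\<dots> \<le> \<phi> / (16 * real d)"
        using X[of \<phi>] \<phi> d by (simp add: field_simps)
      finally have kk: "16 * real d * real k * 2 ^ k \<le> \<phi>" using d by (simp add: field_simps)
      have "4 * real n * 2 ^ k \<le> 4 * (4 * real d * real k * real m) * 2 ^ k"
        using nm by (intro mult_right_mono mult_left_mono) auto
      also have "\<dots> = (16 * real d * real k * 2 ^ k) * real m" by (simp add: algebra_simps)
      also have "\<dots> \<le> \<phi> * real m" using kk by (intro mult_right_mono) auto
      finally have "2 * real n / (real m * \<phi>) * 2 ^ k \<le> 1 / 2"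
        using m1 \<phi> by (simp add: field_simps)
      moreover have "1 / \<phi> \<le> 1 / 2" using \<phi> by (simp add: field_simps)
      ultimately show ?thesis by linarith
    qed
    moreover have "\<phi> powr (real d - 1) / 2 ^ d \<le> 2 ^ (k * d) \<or> real n / 4 \<le> real (k * d)"
    proof (cases "k0 \<le> n div (2 * d)")
      case True
      \<comment> \<open>Rounding down costs at most one bit per profit, hence the factor
        \<open>2 ^ d\<close>.\<close>
      have "(real d - 1) * log 2 \<phi> - real d = (\<gamma> * log 2 \<phi> - 1) * real d"
        using d by (simp add: \<gamma>_def field_simps)
      also have "\<dots> \<le> real k0 * real d" using k0 by (intro mult_right_mono) auto
      finally have "2 powr ((real d - 1) * log 2 \<phi> - real d) \<le> 2 powr (real k0 * real d)"
        by (intro powr_mono) auto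
      moreover have "2 powr ((real d - 1) * log 2 \<phi>) = (2 powr log 2 \<phi>) powr (real d - 1)"
        by (simp only: powr_powr mult.commute)
      then have "2 powr ((real d - 1) * log 2 \<phi> - real d) = \<phi> powr (real d - 1) / 2 ^ d"
        using \<phi> by (simp add: powr_diff powr_realpow)
      moreover have "2 powr (real k0 * real d) = (2::real) ^ (k * d)"
        using True by (simp add: k_def powr_realpow[symmetric])
      ultimately show ?thesis by simp
    next
      case False
      then have k: "k = n div (2 * d)" by (simp add: k_def)
      have "n < (k + 1) * (2 * d)"
        unfolding k using d by (metis Suc_eq_plus1 dividend_less_div_times add.commute mult_Suc mult_pos_pos zero_less_numeral less_le_trans)
      also have "\<dots> \<le> (2 * k) * (2 * d)" using k1 by (intro mult_right_mono) auto
      finally have "n \<le> 4 * (k * d)" by (simp add: algebra_simps)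
      then have "real n \<le> real (4 * (k * d))" by (rule of_nat_mono)
      then show ?thesis by simp
    qed
    ultimately show ?thesis using m1 by (intro exI[of _ k] exI[of _ m]) auto
  qed
  then show ?thesis by (intro exI[of _ "max 4 X"]) auto
qed

text \<open>The construction reaches the exponent \<open>d - 1\<close>, which suffices because
  \<open>log 2 d \<ge> 1\<close>. For \<open>\<phi> \<le> C\<close> the factor
  \<open>1 - C / \<phi>\<close> makes the target exponent nonpositive, and the base part alone is
  enough.\<close>

theorem theorem4:
  fixes d :: nat
  assumes "d \<ge> 2"
  shows "\<exists>c > 0. \<exists>C > 0. \<exists>c' > 0. \<forall>(n::nat) (\<phi>::real). \<phi> > 1 \<longrightarrow>
    (\<exists>(w :: nat \<Rightarrow> real) (a :: nat \<Rightarrow> nat \<Rightarrow> real) (b :: nat \<Rightarrow> nat \<Rightarrow> real)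
        (S :: (nat \<Rightarrow> real) set).
       (\<forall>j<n. w j \<ge> 0) \<and>
       (\<forall>i<d. \<forall>j<n. 0 \<le> a i j \<and> a i j \<le> b i j \<and> b i j \<le> 1 \<and> b i j - a i j \<ge> 1 / \<phi>) \<and>
       S \<subseteq> ({..<n} \<rightarrow>\<^sub>E {0, 1}) \<and>
       (\<integral>v. real (num_pareto d n S w v) \<partial>profit_distr d n a b)
         \<ge> min (c * real n powr (real d - 3/2) * \<phi> powr ((real d - log 2 (real d)) * (1 - C / \<phi>)))
               (2 powr (c' * real n)))"
proof -
  obtain c1 n1 where c1: "c1 > 0" and grid: "\<And>n. n \<ge> n1 \<Longrightarrow> \<exists>R>0.
    (real R ^ (d - 1))\<^sup>2 * exp (- real (n div 2) / (16 * real d * real R)) \<le> 1 / 2 \<and>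
    c1 * real n powr (real d - 3/2) \<le> real R ^ (d - 1)"
    using grid_size[OF assms] by blast
  obtain C where C: "C \<ge> 4" and clone: "\<And>\<phi> n. \<phi> > C \<Longrightarrow> n \<ge> 4 * d \<Longrightarrow>
    \<exists>k m. m > 0 \<and> n div 2 + k * d * m \<le> n \<and>
    2 * real n / (real m * \<phi>) * 2 ^ k + 1 / \<phi> \<le> 1 \<and>
    (\<phi> powr (real d - 1) / 2 ^ d \<le> 2 ^ (k * d) \<or> real n / 4 \<le> real (k * d))"
    using clone_parameters[OF assms] by blast
  define n0 where "n0 = max n1 (4 * d)"
  \<comment> \<open>The 2 accounts for the event of probability 1/2, the \<open>2 ^ d\<close> for
    rounding the number of bits.\<close>
  define c where "c = c1 / (2 * 2 ^ d)"
  \<comment> \<open>\<open>1 / n0\<close> keeps the exponential target at most 2 for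
    \<open>n < n0\<close>; \<open>1 / 8\<close> gives \<open>n / 8 \<le> n / 4 - 1\<close> for
    \<open>n \<ge> 8\<close>, where the 1 absorbs the probability 1/2.\<close>
  define c' where "c' = min (1 / 8) (1 / real n0)"
  have n0: "n0 \<ge> 8" using assms by (simp add: n0_def)
  have c: "c > 0" "c \<le> c1 / 2"
    using c1 by (auto simp: c_def field_simps intro: order_trans[OF _ mult_left_mono[of 1 "2 ^ d"]])
  have c': "c' > 0" using n0 by (simp add: c'_def)
  define L where "L = real d - log 2 (real d)"
  have L: "0 \<le> L" "L \<le> real d - 1"
  proof -
    have "log 2 2 \<le> log 2 (real d)" using assms by (intro log_mono) auto
    then show "L \<le> real d - 1" by (simp add: L_def)
    have "log 2 (real d) \<le> log 2 (2 ^ d)"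
      using assms by (intro log_mono) (auto intro: less_imp_le of_nat_less_two_power)
    then show "0 \<le> L" by (simp add: L_def log_nat_power)
  qed
  let ?T = "\<lambda>n \<phi>. min (c * real n powr (real d - 3/2) * \<phi> powr (L * (1 - C / \<phi>))) (2 powr (c' * real n))"
  have "achievable d n \<phi> (?T n \<phi>)" if \<phi>: "\<phi> > 1" for n and \<phi> :: real
  proof -
    consider "n = 0" | "1 \<le> n" "n < n0" | "n \<ge> n0" "\<phi> \<le> C" | "n \<ge> n0" "\<phi> > C" by linarith
    then show ?thesis
    proof cases
      case 1
      \<comment> \<open>\<open>0 powr a\<close> is 0, so the polynomial term vanishes and the empty
        solution set will do.\<close>
      have "?T n \<phi> \<le> 0" using 1 by simp
      then show ?thesis using 1 unfolding achievable_def
        by (intro exI[of _ "{}"] exI[of _ "\<lambda>_. 0"] exI[of _ "\<lambda>_ _. 0"] exI conjI)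
          (auto intro: order_trans[OF _ integral_nonneg])
    next
      case 2
      have "c' * real n \<le> 1 / real n0 * real n0"
        using 2 n0 by (intro mult_mono) (auto simp: c'_def)
      then have "2 powr (c' * real n) \<le> 2 powr 1" using n0 by (intro powr_mono) auto
      then have "?T n \<phi> \<le> 2" by simp
      then show ?thesis using assms 2 \<phi> by (intro achievable_mono[OF expected_pareto_ge_2]) auto
    next
      case 3
      then obtain R where R: "R > 0"
        "(real R ^ (d - 1))\<^sup>2 * exp (- real (n div 2) / (16 * real d * real R)) \<le> 1 / 2"
        "c1 * real n powr (real d - 3/2) \<le> real R ^ (d - 1)"
        using grid[of n] by (auto simp: n0_def)
      have "L * (1 - C / \<phi>) \<le> 0"
        using 3 \<phi> L by (intro mult_nonneg_nonpos) (auto simp: field_simps)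
      then have "\<phi> powr (L * (1 - C / \<phi>)) \<le> \<phi> powr 0" using \<phi> by (intro powr_mono) auto
      then have "c * real n powr (real d - 3/2) * \<phi> powr (L * (1 - C / \<phi>))
        \<le> (c1 / 2) * real n powr (real d - 3/2) * 1"
        using c c1 \<phi> by (intro mult_mono) auto
      also have "\<dots> \<le> real R ^ (d - 1) * 2 ^ (0 * d) / 2" using R by simp
      finally have "?T n \<phi> \<le> real R ^ (d - 1) * 2 ^ (0 * d) / 2" by (rule min.coboundedI1)
      then show ?thesis using assms \<phi> R 3 n0
        by (intro achievable_mono[OF expected_pareto_ge[where p = "n div 2" and m = 1]]) auto
    next
      case 4
      then obtain R where R: "R > 0"
        "(real R ^ (d - 1))\<^sup>2 * exp (- real (n div 2) / (16 * real d * real R)) \<le> 1 / 2"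
        "c1 * real n powr (real d - 3/2) \<le> real R ^ (d - 1)"
        using grid[of n] by (auto simp: n0_def)
      obtain k m where km: "m > 0" "n div 2 + k * d * m \<le> n"
        "2 * real n / (real m * \<phi>) * 2 ^ k + 1 / \<phi> \<le> 1"
        and or: "\<phi> powr (real d - 1) / 2 ^ d \<le> 2 ^ (k * d) \<or> real n / 4 \<le> real (k * d)"
        using clone[of \<phi> n] 4 by (auto simp: n0_def)
      have "?T n \<phi> \<le> real R ^ (d - 1) * 2 ^ (k * d) / 2"
        using or
      proof
        assume *: "\<phi> powr (real d - 1) / 2 ^ d \<le> 2 ^ (k * d)"
        have "L * (1 - C / \<phi>) \<le> (real d - 1) * 1"
          using L 4 C \<phi> by (intro mult_mono) (auto simp: field_simps)
        then have "\<phi> powr (L * (1 - C / \<phi>)) \<le> \<phi> powr (real d - 1)"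
          using \<phi> by (intro powr_mono) auto
        then have "c * real n powr (real d - 3/2) * \<phi> powr (L * (1 - C / \<phi>))
          \<le> c * real n powr (real d - 3/2) * \<phi> powr (real d - 1)"
          using c by (intro mult_left_mono) auto
        also have "\<dots> = c1 * real n powr (real d - 3/2) * (\<phi> powr (real d - 1) / 2 ^ d) / 2"
          by (simp add: c_def)
        also have "\<dots> \<le> real R ^ (d - 1) * 2 ^ (k * d) / 2"
          using R * by (intro divide_right_mono mult_mono) auto
        finally show ?thesis by (rule min.coboundedI1)
      next
        assume *: "real n / 4 \<le> real (k * d)"
        have "c' * real n \<le> 1 / 8 * real n" by (intro mult_right_mono) (auto simp: c'_def)
        then have "c' * real n \<le> real (k * d) - 1" using * 4 n0 by linarith
        then have "2 powr (c' * real n) \<le> 2 powr (real (k * d) - 1)" by (intro powr_mono) auto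
        also have "\<dots> = 2 ^ (k * d) / 2" by (simp only: powr_diff powr_realpow) simp
        also have "\<dots> \<le> real R ^ (d - 1) * 2 ^ (k * d) / 2" using R by simp
        finally show ?thesis by (rule min.coboundedI2)
      qed
      then show ?thesis using assms \<phi> R 4 n0 km
        by (intro achievable_mono[OF expected_pareto_ge[where p = "n div 2" and m = m]]) auto
    qed
  qed
  then show ?thesis unfolding L_def achievable_def using c c' C
    by (intro exI[of _ c] exI[of _ C] exI[of _ c'] conjI) auto
qed

end
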